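(* As formal power series in $q$ with integer coefficients, \[ \sum_{n=0}^\infty \bar{p}(40n+35)q^n \equiv 2\frac{f_2^{122}}{f_1^{63}f_4^{40}} +3 \frac{f_1f_2^{26}}{f_4^8} +4q\frac{f_2^{98}}{f_1^{55}f_4^{24}} +3qf_1^9f_2^2f_4^8 +4q^2\frac{f_2^{74}}{f_1^{47}f_4^8} +4q^3\frac{f_2^{50}f_4^8}{f_1^{39}} +4q^4\frac{f_2^{26}f_4^{24}}{f_1^{31}} + 2q^{5} \frac{f_2^2f_4^{40}}{f_1^{23}} \pmod{5}, \] where the congruence means coefficientwise congruence modulo $5$.
   Context: For a positive integer $n$, $f_n=\prod_{k=1}^\infty (1-q^{nk})$. An overpartition of a positive integer $n$ is a partition of $n$ in which the first occurrence of each distinct part may be overlined; $\bar{p}(n)$ is the number of overpartitions of $n$ for $n\geq1$, and $\bar{p}(0)=1$. Equivalently, $\sum_{n\geq 0}\bar{p}(n)q^n=f_2/f_1^2$. *)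

theory Defs
  imports "HOL-Computational_Algebra.Formal_Power_Series" "HOL-Library.Multiset"
          "HOL-Number_Theory.Cong"
begin

(* Overpartitions of n: a partition of n (multiset of positive parts summing to n)
   together with the set of distinct parts whose first occurrence is overlined. *)
definition overpartitions :: "nat \<Rightarrow> (nat multiset \<times> nat set) set" where
  "overpartitions n = {(M, S). (\<forall>x\<in>#M. 0 < x) \<and> sum_mset M = n \<and> S \<subseteq> set_mset M}"

definition pbar :: "nat \<Rightarrow> nat" where
  "pbar n = card (overpartitions n)"

(* f_n = prod_{k>=1} (1 - q^{nk}) as an integer formal power series: the coefficient
   of q^m agrees with that of the finite product over k = 1..m (for n >= 1). *)
definition f :: "nat \<Rightarrow> int fps" where
  "f n = Abs_fps (\<lambda>m. fps_nth (\<Prod>k=1..m. (1 - fps_X ^ (n * k) :: int fps)) m)"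

definition fps_inv1 :: "int fps \<Rightarrow> int fps" where
  "fps_inv1 g = fps_right_inverse g 1"

end

theory Submission
  imports Defs
begin

text \<open>
  Both sides vanish modulo 5.

  For the left-hand side, let \<open>\<theta>(q) = \<Sum> q\<^bsup>x\<^sup>2\<^esup>\<close> over all integers \<open>x\<close>. Gauss' product formula
  \<open>\<theta>(-q) = f\<^sub>1\<^sup>2/f\<^sub>2\<close> shows that the overpartition series is \<open>1/\<theta>(-q)\<close>, which modulo 5 is
  \<open>\<theta>(-q)\<^sup>4/\<theta>(-q\<^sup>5)\<close>. Writing \<open>r\<^sub>k\<close> for the number of representations as a sum of \<open>k\<close> squares, the relation
  \<open>r\<^sub>2(5n) = 2r\<^sub>2(n) - r\<^sub>2(n/5)\<close> implies \<open>r\<^sub>4(5n) = 6r\<^sub>4(n) - 5r\<^sub>4(n/5)\<close>. Hence the number of overpartitions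
  of \<open>5n\<close> is congruent to \<open>(-1)\<^sup>n r\<^sub>3(n)\<close>, and no number \<open>8n + 7\<close> is a sum of three squares.

  For the right-hand side, put \<open>A = f\<^sub>2\<^bsup>24\<^esup>\<close>, \<open>B = q f\<^sub>1\<^sup>8 f\<^sub>4\<^bsup>16\<^esup>\<close> and \<open>C = f\<^sub>1\<^bsup>16\<^esup> f\<^sub>4\<^sup>8\<close>. After clearing
  denominators it equals \<open>f\<^sub>2\<^sup>2 (A + B) (2(A\<^sup>4 + A\<^sup>3B + A\<^sup>2B\<^sup>2 + AB\<^sup>3 + B\<^sup>4) + 3C\<^sup>4)\<close>, where the quartic in
  \<open>A\<close> and \<open>B\<close> is \<open>(A - B)\<^sup>4\<close> modulo 5, and Jacobi's identity \<open>A = C + 16B\<close> gives \<open>A - B = C\<close> modulo 5.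
  Jacobi's identity is \<open>\<theta>(q)\<^sup>4 - \<theta>(-q)\<^sup>4 = 16q f\<^sub>4\<^sup>8/f\<^sub>2\<^sup>4\<close>; both of its sides satisfy the functional equation
  \<open>D(q)\<^sup>2 = 16 \<theta>(q\<^sup>2)\<^sup>4 D(q\<^sup>2)\<close>, which has only one solution with leading term \<open>16q\<close>.
\<close>

section \<open>Truncated equality of power series\<close>

text \<open>Infinite products are handled by comparison with finite ones up to an arbitrary degree
  m. The relation respects products, powers and sums, and \<open>agree_eqI\<close> recovers
  equality.\<close>

definition agree :: "nat \<Rightarrow> 'a::comm_ring_1 fps \<Rightarrow> 'a fps \<Rightarrow> bool" where
  "agree m F G \<longleftrightarrow> (\<forall>k\<le>m. fps_nth F k = fps_nth G k)"

lemma agree_refl [simp]: "agree m F F"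
  by (simp add: agree_def)

lemma agree_sym: "agree m F G \<Longrightarrow> agree m G F"
  by (simp add: agree_def)

lemma agree_trans [trans]: "agree m F G \<Longrightarrow> agree m G H \<Longrightarrow> agree m F H"
  by (simp add: agree_def)

lemma agree_mult: "agree m F F' \<Longrightarrow> agree m G G' \<Longrightarrow> agree m (F * G) (F' * G')"
  by (auto simp: agree_def fps_mult_nth intro!: sum.cong)

lemma agree_power: "agree m F G \<Longrightarrow> agree m (F ^ k) (G ^ k)"
  by (induction k) (simp_all add: agree_mult)

lemma agree_sum: "(\<And>i. i \<in> I \<Longrightarrow> agree m (F i) (G i)) \<Longrightarrow> agree m (sum F I) (sum G I)"
  by (induction I rule: infinite_finite_induct) (simp_all add: agree_def)

lemma agree_eqI: "(\<And>m. agree m F G) \<Longrightarrow> F = G"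
  by (auto simp: agree_def fps_eq_iff)

lemma agree_X_power_mult: "m < k \<Longrightarrow> agree m (fps_X ^ k * F) 0"
  by (simp add: agree_def fps_X_power_mult_nth)

text \<open>A factor with k > i changes only degrees d*k > i, so the coefficient of q^i is constant
  from M = i on, and M = i is the value used in \<open>f\<close>.\<close>

lemma agree_prod_one_minus_X_power:
  assumes "0 < d" and "m \<le> M"
  shows "agree m (\<Prod>k=1..M. (1 - fps_X ^ (d * k)) :: int fps) (f d)"
proof -
  have step: "fps_nth (\<Prod>k=1..M. (1 - fps_X ^ (d * k)) :: int fps) i = fps_nth (f d) i"
    if "i \<le> M" for i M
    using that
  proof (induction M rule: dec_induct)
    case base
    show ?case by (simp add: f_def)
  next
    case (step M)
    have "i < d * Suc M"
      using step.hyps assms(1) mult_le_mono1[of 1 d "Suc M"] by simp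
    thus ?case
      using step by (simp add: algebra_simps fps_X_power_mult_nth del: mult_Suc mult_Suc_right)
  qed
  thus ?thesis using assms by (auto simp: agree_def)
qed

lemma f_nth_0 [simp]: "fps_nth (f d) 0 = 1"
  by (simp add: f_def)

lemma f_nonzero [simp]: "f d \<noteq> 0"
  using f_nth_0[of d] by (metis fps_zero_nth zero_neq_one)

lemma fps_inv1_right: "fps_nth g 0 = 1 \<Longrightarrow> g * fps_inv1 g = 1"
  unfolding fps_inv1_def by (rule fps_right_inverse) simp

section \<open>The substitutions q -> q^k and q -> -q\<close>

lemma fps_nth_compose_X_power:
  fixes F :: "'a::comm_ring_1 fps"
  assumes "0 < k"
  shows "fps_nth (F oo fps_X ^ k) n = (if k dvd n then fps_nth F (n div k) else 0)"
proof -
  have "fps_nth (F oo fps_X ^ k) n = (\<Sum>i=0..n. if n = k * i then fps_nth F i else 0)"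
    by (auto simp: fps_compose_nth power_mult[symmetric] intro!: sum.cong)
  also have "\<dots> = (\<Sum>i\<in>{i. i \<le> n \<and> n = k * i}. fps_nth F i)"
    by (rule sum.mono_neutral_cong_right) auto
  also have "{i. i \<le> n \<and> n = k * i} = (if k dvd n then {n div k} else {})"
    using assms by auto
  finally show ?thesis by simp
qed

lemma fps_nth_compose_minus_X:
  "fps_nth (F oo - fps_X) n = (-1) ^ n * fps_nth (F :: int fps) n"
  using fps_nth_compose_linear[of F "-1" n] by (simp flip: fps_const_neg)

lemma f_compose_X_power:
  assumes "0 < d" "0 < e"
  shows "f d oo fps_X ^ e = f (d * e)"
proof (rule agree_eqI)
  fix m
  have "agree m (f d oo fps_X ^ e) ((\<Prod>k=1..m. (1 - fps_X ^ (d * k))) oo fps_X ^ e)"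
    using agree_prod_one_minus_X_power[OF assms(1), of m m] assms(2)
    by (auto simp: agree_def fps_nth_compose_X_power)
       (metis div_le_dividend le_trans)
  also have "(\<Prod>k=1..m. (1 - fps_X ^ (d * k)) :: int fps) oo fps_X ^ e
     = (\<Prod>k=1..m. (1 - fps_X ^ (d * e * k)))"
    using assms(2)
    by (subst fps_compose_prod_distrib)
       (simp_all add: fps_compose_sub_distrib fps_X_power_compose power_mult[symmetric] mult_ac)
  also have "agree m \<dots> (f (d * e))"
    using assms by (intro agree_prod_one_minus_X_power) auto
  finally show "agree m (f d oo fps_X ^ e) (f (d * e))" .
qed

section \<open>The generating function of overpartitions\<close>

text \<open>A bound on the parts allows induction on the bound. For N >= n it excludes nothing, as
  no part exceeds the sum.\<close>

definition bounded_overpartitions :: "nat \<Rightarrow> nat \<Rightarrow> (nat multiset \<times> nat set) set" where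
  "bounded_overpartitions N n =
     {(M, S). set_mset M \<subseteq> {1..N} \<and> sum_mset M = n \<and> S \<subseteq> set_mset M}"

lemma member_le_sum_mset: "x \<in># M \<Longrightarrow> x \<le> sum_mset (M :: nat multiset)"
  by (induction M) auto

lemma size_le_sum_mset: "(\<forall>x\<in>#M. 0 < x) \<Longrightarrow> size M \<le> sum_mset (M :: nat multiset)"
  by (induction M) auto

lemma finite_bounded_overpartitions: "finite (bounded_overpartitions N n)"
proof (rule finite_subset)
  show "bounded_overpartitions N n \<subseteq>
      mset ` {xs. set xs \<subseteq> {1..N} \<and> length xs \<le> n} \<times> Pow {1..N}"
  proof clarify
    fix M S assume *: "(M, S) \<in> bounded_overpartitions N n"
    hence "\<forall>x\<in>#M. 0 < x" by (auto simp: bounded_overpartitions_def)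
    hence "size M \<le> n"
      using size_le_sum_mset[of M] * by (simp add: bounded_overpartitions_def)
    moreover obtain xs where "mset xs = M" using ex_mset by blast
    ultimately show "M \<in> mset ` {xs. set xs \<subseteq> {1..N} \<and> length xs \<le> n} \<and> S \<in> Pow {1..N}"
      using * by (auto simp: bounded_overpartitions_def intro!: image_eqI[of _ _ xs])
  qed
  show "finite (mset ` {xs. set xs \<subseteq> {1..N} \<and> length xs \<le> n} \<times> Pow {1..N})"
    by (simp add: finite_lists_length_le)
qed

lemma overpartitions_eq_bounded:
  assumes "n \<le> N"
  shows "overpartitions n = bounded_overpartitions N n"
proof -
  have "(\<forall>x\<in>#M. 0 < x) \<longleftrightarrow> set_mset M \<subseteq> {1..N}" if "sum_mset M = n" for M
    using member_le_sum_mset[of _ M] that assms by (fastforce simp: Suc_le_eq)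
  thus ?thesis
    unfolding overpartitions_def bounded_overpartitions_def by blast
qed

lemma bounded_overpartitions_0: "bounded_overpartitions 0 n = (if n = 0 then {({#}, {})} else {})"
  by (auto simp: bounded_overpartitions_def)

text \<open>With K = N + 1 there are three cases: K is absent; one copy of K can be removed with the
  overlined set still admissible; or K occurs exactly once and is overlined, so that its overline
  has to be removed too.\<close>

lemma card_bounded_overpartitions_Suc:
  "card (bounded_overpartitions (Suc N) n) = card (bounded_overpartitions N n) +
     (if n < Suc N then 0 else card (bounded_overpartitions (Suc N) (n - Suc N))
        + card (bounded_overpartitions N (n - Suc N)))"
proof -
  let ?K = "Suc N"
  define without where "without = bounded_overpartitions N n"
  define plain where "plain = (if n < ?K then {} else
     (\<lambda>(M, S). (add_mset ?K M, S)) ` bounded_overpartitions ?K (n - ?K))"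
  define over where "over = (if n < ?K then {} else
     (\<lambda>(M, S). (add_mset ?K M, insert ?K S)) ` bounded_overpartitions N (n - ?K))"
  have notin: "?K \<notin># M" "?K \<notin> S" if "(M, S) \<in> bounded_overpartitions N k" for M S k
    using that by (auto simp: bounded_overpartitions_def)
  have split: "bounded_overpartitions ?K n = without \<union> (plain \<union> over)"
  proof (rule set_eqI, rule iffI)
    fix z assume z: "z \<in> bounded_overpartitions ?K n"
    obtain M S where MS: "z = (M, S)" by (cases z)
    show "z \<in> without \<union> (plain \<union> over)"
    proof (cases "?K \<in># M")
      case False
      hence "z \<in> without"
        using z MS by (force simp: without_def bounded_overpartitions_def atLeastAtMostSuc_conv)
      thus ?thesis by simp
    next
      case True
      then obtain M' where M': "M = add_mset ?K M'" by (metis insert_DiffM)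
      have n: "\<not> n < ?K" "sum_mset M' = n - ?K"
        using z MS M' by (auto simp: bounded_overpartitions_def)
      show ?thesis
      proof (cases "S \<subseteq> set_mset M'")
        case True
        hence "(M', S) \<in> bounded_overpartitions ?K (n - ?K)"
          using z MS M' n by (auto simp: bounded_overpartitions_def)
        thus ?thesis using n MS M' by (force simp: plain_def)
      next
        case False
        hence K: "?K \<in> S" "?K \<notin># M'"
          using z MS M' by (auto simp: bounded_overpartitions_def)
        hence "(M', S - {?K}) \<in> bounded_overpartitions N (n - ?K)"
          using z MS M' n by (force simp: bounded_overpartitions_def atLeastAtMostSuc_conv)
        moreover have "z = (\<lambda>(M, S). (add_mset ?K M, insert ?K S)) (M', S - {?K})"
          using MS M' K by auto
        ultimately have "z \<in> over" using n(1) unfolding over_def by (simp only: if_False imageI)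
        thus ?thesis by simp
      qed
    qed
  next
    fix z assume "z \<in> without \<union> (plain \<union> over)"
    thus "z \<in> bounded_overpartitions ?K n"
      by (auto simp: without_def plain_def over_def bounded_overpartitions_def atLeastAtMostSuc_conv
          split: if_splits)
  qed
  have "?K \<notin># fst z" if "z \<in> without" for z
    using that notin(1)[of "fst z" "snd z" n] by (simp add: without_def)
  moreover have "?K \<in># fst z" if "z \<in> plain \<union> over" for z
    using that by (auto simp: plain_def over_def split: if_splits)
  ultimately have disj1: "without \<inter> (plain \<union> over) = {}" by blast
  \<comment> \<open>The two sets differ in whether every overlined part still occurs after one copy
    of K is removed.\<close>
  have disj2: "plain \<inter> over = {}"
  proof -
    have "snd z \<subseteq> set_mset (fst z - {#?K#})" if "z \<in> plain" for z
      using that by (auto simp: plain_def bounded_overpartitions_def split: if_splits)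
    moreover have "\<not> snd z \<subseteq> set_mset (fst z - {#?K#})" if over: "z \<in> over" for z
    proof -
      obtain M S where "(M, S) \<in> bounded_overpartitions N (n - ?K)"
        and "z = (add_mset ?K M, insert ?K S)"
        using over by (auto simp: over_def split: if_splits)
      thus ?thesis using notin(1)[of M S] by auto
    qed
    ultimately show ?thesis by blast
  qed
  have "inj_on (\<lambda>(M, S). (add_mset ?K M, S)) (bounded_overpartitions ?K (n - ?K))"
    by (auto simp: inj_on_def)
  hence plain: "card plain = (if n < ?K then 0 else card (bounded_overpartitions ?K (n - ?K)))"
    by (simp add: plain_def card_image)
  have "inj_on (\<lambda>(M, S). (add_mset ?K M, insert ?K S)) (bounded_overpartitions N (n - ?K))"
  proof (rule inj_onI, clarify)
    fix M S M' S'
    assume "(M, S) \<in> bounded_overpartitions N (n - ?K)" "(M', S') \<in> bounded_overpartitions N (n - ?K)"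
      and eq: "add_mset ?K M = add_mset ?K M'" "insert ?K S = insert ?K S'"
    hence "?K \<notin> S" "?K \<notin> S'" using notin by blast+
    thus "M = M' \<and> S = S'" using eq by (metis add_mset_add_mset_same_iff insert_ident)
  qed
  hence over: "card over = (if n < ?K then 0 else card (bounded_overpartitions N (n - ?K)))"
    by (simp add: over_def card_image)
  have "finite without" "finite plain" "finite over"
    by (simp_all add: without_def plain_def over_def finite_bounded_overpartitions)
  thus ?thesis
    using disj1 disj2 plain over unfolding split by (simp add: card_Un_disjoint without_def)
qed

text \<open>By the recurrence, passing from N to N + 1 multiplies the series by (1 + q^(N+1)) / (1 -
  q^(N+1)).\<close>

lemma bounded_overpartitions_gf:
  "Abs_fps (\<lambda>n. int (card (bounded_overpartitions N n))) * (\<Prod>k=1..N. 1 - fps_X ^ k)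
     = (\<Prod>k=1..N. 1 + fps_X ^ k)"
proof (induction N)
  case 0
  show ?case by (auto simp: fps_eq_iff bounded_overpartitions_0)
next
  case (Suc N)
  let ?P = "\<lambda>N. Abs_fps (\<lambda>n. int (card (bounded_overpartitions N n)))"
  have "?P (Suc N) = ?P N + fps_X ^ Suc N * (?P (Suc N) + ?P N)"
    by (rule fps_ext) (simp add: fps_X_power_mult_nth card_bounded_overpartitions_Suc[of N]
        del: power_Suc)
  hence rec: "?P (Suc N) * (1 - fps_X ^ Suc N) = ?P N * (1 + fps_X ^ Suc N)"
    by (simp add: algebra_simps del: power_Suc)
  have "?P (Suc N) * (\<Prod>k=1..Suc N. 1 - fps_X ^ k)
      = (?P (Suc N) * (1 - fps_X ^ Suc N)) * (\<Prod>k=1..N. 1 - fps_X ^ k)"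
    by (simp add: mult_ac del: power_Suc)
  also have "\<dots> = (?P N * (\<Prod>k=1..N. 1 - fps_X ^ k)) * (1 + fps_X ^ Suc N)"
    unfolding rec by (simp add: mult_ac del: power_Suc)
  also have "\<dots> = (\<Prod>k=1..Suc N. 1 + fps_X ^ k)"
    unfolding Suc.IH by (simp del: power_Suc)
  finally show ?case .
qed

definition pbar_gf :: "int fps" where
  "pbar_gf = Abs_fps (\<lambda>n. int (pbar n))"

text \<open>One factor \<open>f 1\<close> cancels the denominator of the generating function, the
  other combines with the numerator through (1 + q^k)(1 - q^k) = 1 - q^(2k).\<close>

lemma pbar_gf_eq: "pbar_gf * f 1 ^ 2 = f 2"
proof (rule agree_eqI)
  fix m
  let ?P = "Abs_fps (\<lambda>n. int (card (bounded_overpartitions m n)))"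
  let ?e = "\<Prod>k=1..m. 1 - fps_X ^ k :: int fps"
  have e: "agree m ?e (f 1)"
    using agree_prod_one_minus_X_power[of 1 m m] by simp
  have "agree m pbar_gf ?P"
    by (simp add: agree_def pbar_gf_def pbar_def overpartitions_eq_bounded[of _ m])
  hence "agree m (pbar_gf * f 1 ^ 2) (?P * ?e ^ 2)"
    by (intro agree_mult agree_power agree_sym[OF e])
  also have "?P * ?e ^ 2 = (\<Prod>k=1..m. 1 + fps_X ^ k) * ?e"
    using bounded_overpartitions_gf[of m] by (simp add: power2_eq_square flip: mult.assoc)
  also have "\<dots> = (\<Prod>k=1..m. 1 - fps_X ^ (2 * k))"
    by (simp add: algebra_simps mult_2_right power_add flip: prod.distrib)
  also have "agree m \<dots> (f 2)"
    by (rule agree_prod_one_minus_X_power) auto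
  finally show "agree m (pbar_gf * f 1 ^ 2) (f 2)" .
qed

section \<open>Theta series\<close>

text \<open>Counting roots with both signs makes the coefficients of \<open>theta ^ k\<close> the
  numbers of representations by k squares of integers.\<close>

definition theta :: "int fps" where
  "theta = Abs_fps (\<lambda>n. int (card {x :: int. x ^ 2 = int n}))"

definition alt_theta :: "int fps" where
  "alt_theta = theta oo - fps_X"

definition two_square_reps :: "nat \<Rightarrow> (int \<times> int) set" where
  "two_square_reps n = {(x, y). x ^ 2 + y ^ 2 = int n}"

lemma abs_le_square_int: "\<bar>x :: int\<bar> \<le> x ^ 2"
  using self_le_power[of "\<bar>x\<bar>" 2] by (cases "x = 0") auto

lemma finite_square_roots: "finite {x :: int. x ^ 2 = int n}"
proof (rule finite_subset)
  show "{x :: int. x ^ 2 = int n} \<subseteq> {- int n..int n}"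
  proof
    fix x :: int assume "x \<in> {x. x ^ 2 = int n}"
    thus "x \<in> {- int n..int n}" using abs_le_square_int[of x] by auto
  qed
qed simp

lemma finite_two_square_reps: "finite (two_square_reps n)"
proof (rule finite_subset)
  show "two_square_reps n \<subseteq> {- int n..int n} \<times> {- int n..int n}"
  proof clarify
    fix x y :: int assume "(x, y) \<in> two_square_reps n"
    hence eq: "x ^ 2 + y ^ 2 = int n" by (simp add: two_square_reps_def)
    hence "\<bar>x\<bar> \<le> int n" "\<bar>y\<bar> \<le> int n"
      using abs_le_square_int[of x] abs_le_square_int[of y] zero_le_power2[of x] zero_le_power2[of y]
      by linarith+
    thus "x \<in> {- int n..int n} \<and> y \<in> {- int n..int n}" by auto
  qed
qed simp

lemma theta_square_nth: "fps_nth (theta ^ 2) n = int (card (two_square_reps n))"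
proof -
  let ?R = "\<lambda>n. {x :: int. x ^ 2 = int n}"
  have "two_square_reps n = (\<Union>i\<in>{0..n}. ?R i \<times> ?R (n - i))"
  proof (rule set_eqI, clarify)
    fix x y :: int
    show "(x, y) \<in> two_square_reps n \<longleftrightarrow> (x, y) \<in> (\<Union>i\<in>{0..n}. ?R i \<times> ?R (n - i))"
    proof
      assume "(x, y) \<in> two_square_reps n"
      hence eq: "x ^ 2 + y ^ 2 = int n" by (simp add: two_square_reps_def)
      hence "nat (x ^ 2) \<le> n" using zero_le_power2[of y] by linarith
      moreover have "int (nat (x ^ 2)) = x ^ 2" by simp
      ultimately show "(x, y) \<in> (\<Union>i\<in>{0..n}. ?R i \<times> ?R (n - i))"
        using eq by (intro UN_I[of "nat (x ^ 2)"]) auto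
    qed (auto simp: two_square_reps_def)
  qed
  also have "card \<dots> = (\<Sum>i\<in>{0..n}. card (?R i \<times> ?R (n - i)))"
    by (rule card_UN_disjoint) (use finite_square_roots in \<open>auto simp del: of_nat_diff\<close>)
  finally show ?thesis
    by (simp add: power2_eq_square fps_mult_nth theta_def card_cartesian_product)
qed

lemma theta_nth_0 [simp]: "fps_nth theta 0 = 1"
proof -
  have "{x :: int. x ^ 2 = int 0} = {0}" by auto
  thus ?thesis by (simp add: theta_def)
qed

lemma theta_nth_1 [simp]: "fps_nth theta (Suc 0) = 2"
proof -
  have "{x :: int. x ^ 2 = int (Suc 0)} = {1, -1}" by (auto simp: power2_eq_1_iff)
  thus ?thesis by (simp add: theta_def)
qed

lemma theta_nth_eq_0: "(\<And>x. x ^ 2 \<noteq> n) \<Longrightarrow> fps_nth theta n = 0"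
proof -
  assume *: "\<And>x. x ^ 2 \<noteq> n"
  have "x ^ 2 \<noteq> int n" for x :: int
  proof
    assume "x ^ 2 = int n"
    hence "int (nat \<bar>x\<bar> ^ 2) = int n" by simp
    thus False using * by (metis of_nat_eq_iff)
  qed
  thus ?thesis by (simp add: theta_def)
qed

lemma alt_theta_nth: "fps_nth alt_theta n = (-1) ^ n * fps_nth theta n"
  by (simp add: alt_theta_def fps_nth_compose_minus_X)

lemma alt_theta_power: "alt_theta ^ k = theta ^ k oo - fps_X"
  by (simp add: alt_theta_def fps_compose_power)

section \<open>Gauss' product formula for the alternating theta series\<close>

fun qbin :: "'a::comm_ring_1 \<Rightarrow> nat \<Rightarrow> nat \<Rightarrow> 'a" where
  "qbin Q n 0 = 1"
| "qbin Q 0 (Suc k) = 0"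
| "qbin Q (Suc n) (Suc k) = Q ^ Suc k * qbin Q n (Suc k) + qbin Q n k"

lemma qbin_eq_0: "n < k \<Longrightarrow> qbin Q n k = 0"
  by (induction Q n k rule: qbin.induct) auto

text \<open>Induction with x arbitrary: once the factor k = 0 is split off, the remaining product is
  that for N with x * Q in place of x. Comparison of the coefficients of x^(j+1) is then the Pascal
  recursion of \<open>qbin\<close>.\<close>

theorem qbinomial_theorem:
  "(\<Prod>k<N. y + x * Q ^ k) = (\<Sum>j\<le>N. Q ^ (j choose 2) * qbin Q N j * x ^ j * y ^ (N - j))"
proof (induction N arbitrary: x)
  case 0
  show ?case by (simp add: binomial_eq_0)
next
  case (Suc N)
  define a where "a = (\<lambda>j. Q ^ (j choose 2) * Q ^ j * qbin Q N j)"
  have coeff: "a (Suc j) + a j = Q ^ (Suc j choose 2) * qbin Q (Suc N) (Suc j)" for j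
    by (simp add: a_def numeral_2_eq_2 power_add algebra_simps)
  have "(\<Prod>k<Suc N. y + x * Q ^ k) = (y + x) * (\<Prod>k<N. y + (x * Q) * Q ^ k)"
    by (simp add: prod.lessThan_Suc_shift mult_ac del: prod.lessThan_Suc)
  also have "\<dots> = (y + x) * (\<Sum>j\<le>N. a j * x ^ j * y ^ (N - j))"
    unfolding Suc.IH by (simp add: a_def power_mult_distrib mult_ac)
  also have "\<dots> = (\<Sum>j\<le>N. a j * x ^ j * y ^ (Suc N - j)) + (\<Sum>j\<le>N. a j * x ^ Suc j * y ^ (N - j))"
    by (simp add: distrib_left distrib_right sum_distrib_left sum.distrib[symmetric] Suc_diff_le mult_ac)
  also have "(\<Sum>j\<le>N. a j * x ^ j * y ^ (Suc N - j)) = (\<Sum>j\<le>Suc N. a j * x ^ j * y ^ (Suc N - j))"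
    by (simp add: a_def qbin_eq_0)
  also have "\<dots> = y ^ Suc N + (\<Sum>j\<le>N. a (Suc j) * x ^ Suc j * y ^ (N - j))"
    by (subst sum.atMost_Suc_shift) (simp add: a_def binomial_eq_0)
  also have "\<dots> + (\<Sum>j\<le>N. a j * x ^ Suc j * y ^ (N - j))
      = y ^ Suc N + (\<Sum>j\<le>N. (a (Suc j) + a j) * x ^ Suc j * y ^ (N - j))"
    by (simp add: sum.distrib distrib_right del: power_Suc)
  also have "\<dots> = y ^ Suc N
      + (\<Sum>j\<le>N. Q ^ (Suc j choose 2) * qbin Q (Suc N) (Suc j) * x ^ Suc j * y ^ (N - j))"
    unfolding coeff ..
  also have "\<dots>
      = (\<Sum>j\<le>Suc N. Q ^ (j choose 2) * qbin Q (Suc N) j * x ^ j * y ^ (Suc N - j))"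
    by (subst sum.atMost_Suc_shift) (simp add: binomial_eq_0)
  finally show ?case .
qed

text \<open>The quotient formula for Gaussian binomials, kept free of division. The two Pascal terms
  contribute Q^(i+1) (1 - Q^(N-i)) and 1 - Q^(i+1), which add up to 1 - Q^(N+1).\<close>

lemma qbin_mult_qfact:
  assumes "j \<le> N"
  shows "qbin Q N j * (\<Prod>i=1..j. 1 - Q ^ i) * (\<Prod>i=1..N-j. 1 - Q ^ i) = (\<Prod>i=1..N. 1 - Q ^ i)"
  using assms
proof (induction N arbitrary: j)
  case 0
  thus ?case by simp
next
  case (Suc N)
  let ?p = "\<lambda>k. \<Prod>i=1..k. 1 - Q ^ i"
  show ?case
  proof (cases j)
    case 0
    thus ?thesis by simp
  next
    case (Suc i)
    hence i: "i \<le> N" using Suc.prems by simp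
    have p_Suc: "?p (Suc k) = ?p k * (1 - Q ^ Suc k)" for k by simp
    have low: "qbin Q N i * ?p i * ?p (N - i) = ?p N" using Suc.IH[OF i] .
    \<comment> \<open>For i = N both sides vanish: the left by \<open>qbin_eq_0\<close>, the right
      because 1 - Q^0 = 0.\<close>
    have high: "qbin Q N (Suc i) * ?p (Suc i) * ?p (N - i) = ?p N * (1 - Q ^ (N - i))"
    proof (cases "i = N")
      case True
      thus ?thesis by (simp add: qbin_eq_0)
    next
      case False
      then obtain d where d: "N - i = Suc d" "N - Suc i = d"
        using i by (metis Suc_diff_Suc le_neq_implies_less)
      have "qbin Q N (Suc i) * ?p (Suc i) * ?p d = ?p N"
        using Suc.IH[of "Suc i"] i False d by simp
      thus ?thesis unfolding d p_Suc[of d] by (simp only: mult.assoc[symmetric])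
    qed
    have "qbin Q (Suc N) j * ?p j * ?p (Suc N - j)
        = Q ^ Suc i * (qbin Q N (Suc i) * ?p (Suc i) * ?p (N - i))
          + qbin Q N i * ?p i * ?p (N - i) * (1 - Q ^ Suc i)"
      unfolding Suc by (simp only: qbin.simps diff_Suc_Suc p_Suc[of i]) (simp only: algebra_simps)
    also have "\<dots> = ?p N * (Q ^ Suc i * (1 - Q ^ (N - i)) + (1 - Q ^ Suc i))"
      unfolding high low by (simp only: algebra_simps)
    also have "Q ^ Suc i * (1 - Q ^ (N - i)) + (1 - Q ^ Suc i) = 1 - Q ^ Suc N"
      using i by (simp add: algebra_simps flip: power_add power_Suc)
    finally show ?thesis by simp
  qed
qed

lemma prod_lessThan_add:
  "(\<Prod>k<m + n :: nat. g k) = (\<Prod>k<m. g k) * (\<Prod>k<n. g (m + k) :: 'a::comm_monoid_mult)"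
  by (induction n) (simp_all add: mult_ac)

text \<open>
  The \<open>q\<close>-binomial theorem in base \<open>q\<^sup>2\<close> for \<open>N = 2n\<close>, \<open>x = -1\<close> and \<open>y = q\<^bsup>2n-1\<^esup>\<close>,
  divided by \<open>q\<^bsup>n(3n-2)\<^esup>\<close>: a finite form of the Jacobi triple product at \<open>z = -1\<close>.
\<close>

lemma finite_gauss:
  assumes "0 < n"
  shows "(\<Prod>i<n. 1 - fps_X ^ (2 * i + 1)) ^ 2 =
    (\<Sum>j\<le>2*n. (-1) ^ (n + j) * (fps_X ^ nat ((int j - int n) ^ 2) * qbin (fps_X ^ 2) (2 * n) j) :: int fps)"
proof -
  let ?X = "fps_X :: int fps"
  let ?odd = "\<Prod>i<n. 1 - ?X ^ (2 * i + 1)"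
  \<comment> \<open>The power of q to be cancelled: the factors k < n give n(n-1), the factors n <=
    k < 2n give n(2n-1).\<close>
  define e where "e = n * (n - 1) + n * (2 * n - 1)"
  have tri: "2 * (\<Sum>i<k. i) = k * (k - 1)" for k :: nat
  proof (induction k)
    case (Suc k)
    thus ?case by (cases k) simp_all
  qed simp
  \<comment> \<open>For k < n the smaller exponent is 2k, so q^(2k) is factored out with a sign;
    reversing the order produces the odd exponents 1, 3, ..., 2n-1.\<close>
  have "(\<Prod>k<n. ?X ^ (2*n-1) - ?X ^ (2*k)) = (\<Prod>i<n. ?X ^ (2*n-1) - ?X ^ (2*(n - Suc i)))"
    by (rule prod.nat_diff_reindex[symmetric])
  also have "\<dots> = (\<Prod>i<n. (- 1 * ?X ^ (2*(n - Suc i))) * (1 - ?X ^ (2*i+1)))"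
  proof (rule prod.cong)
    fix i assume "i \<in> {..<n}"
    hence "2*n-1 = 2*(n - Suc i) + (2*i+1)" by auto
    hence "?X ^ (2*n-1) = ?X ^ (2*(n - Suc i)) * ?X ^ (2*i+1)" by (simp only: power_add)
    thus "?X ^ (2*n-1) - ?X ^ (2*(n - Suc i)) = (- 1 * ?X ^ (2*(n - Suc i))) * (1 - ?X ^ (2*i+1))"
      by (simp add: algebra_simps)
  qed simp
  also have "\<dots> = (-1) ^ n * (\<Prod>i<n. ?X ^ (2*(n - Suc i))) * ?odd"
    by (simp only: prod.distrib prod_constant card_lessThan)
  also have "(\<Prod>i<n. ?X ^ (2*(n - Suc i))) = (\<Prod>i<n. ?X ^ (2*i))"
    by (rule prod.nat_diff_reindex[of "\<lambda>i. ?X ^ (2*i)"])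
  also have "\<dots> = ?X ^ (n * (n - 1))"
    by (simp only: power_sum[symmetric] sum_distrib_left[symmetric] tri)
  finally have low: "(\<Prod>k<n. ?X ^ (2*n-1) - ?X ^ (2*k)) = (-1) ^ n * ?X ^ (n * (n - 1)) * ?odd" .
  have "(\<Prod>i<n. ?X ^ (2*n-1) - ?X ^ (2*(n+i))) = (\<Prod>i<n. ?X ^ (2*n-1) * (1 - ?X ^ (2*i+1)))"
  proof (rule prod.cong)
    fix i
    have "2*(n+i) = (2*n-1) + (2*i+1)" using assms by auto
    hence "?X ^ (2*(n+i)) = ?X ^ (2*n-1) * ?X ^ (2*i+1)" by (simp only: power_add)
    thus "?X ^ (2*n-1) - ?X ^ (2*(n+i)) = ?X ^ (2*n-1) * (1 - ?X ^ (2*i+1))"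
      by (simp add: algebra_simps)
  qed simp
  also have "\<dots> = ?X ^ (n * (2*n-1)) * ?odd"
    by (simp only: prod.distrib prod_constant card_lessThan power_mult[symmetric] mult.commute)
  finally have high: "(\<Prod>i<n. ?X ^ (2*n-1) - ?X ^ (2*(n+i))) = ?X ^ (n * (2*n-1)) * ?odd" .
  have "?X ^ e * ((-1) ^ n * ?odd ^ 2) = (\<Prod>k<n + n. ?X ^ (2*n-1) - ?X ^ (2*k))"
    unfolding prod_lessThan_add low high e_def power_add by (simp add: power2_eq_square mult_ac)
  also have "\<dots> = (\<Prod>k<2*n. ?X ^ (2*n-1) + (-1) * (?X ^ 2) ^ k)"
    by (simp add: mult_2 flip: power_mult)
  also have "\<dots> = (\<Sum>j\<le>2*n. (?X ^ 2) ^ (j choose 2) * qbin (?X ^ 2) (2*n) j * (-1) ^ j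
      * (?X ^ (2*n-1)) ^ (2*n - j))"
    by (rule qbinomial_theorem)
  also have "\<dots> = (\<Sum>j\<le>2*n. ?X ^ e * ((-1) ^ j * (?X ^ nat ((int j - int n) ^ 2) * qbin (?X ^ 2) (2*n) j)))"
  proof (rule sum.cong)
    fix j assume "j \<in> {..2*n}"
    hence j: "j \<le> 2 * n" by simp
    have two: "int (2 * (j choose 2)) = int j * (int j - 1)"
      by (induction j) (simp_all add: numeral_2_eq_2 algebra_simps)
    \<comment> \<open>Completing the square in j, over the integers because of the subtractions:
      j(j-1) + (2n-1)(2n-j) = n(3n-2) + (j-n)^2.\<close>
    have "int (2 * (j choose 2) + (2*n-1) * (2*n-j)) = int (e + nat ((int j - int n) ^ 2))"
    proof -
      have eqs: "int (n - 1) = int n - 1" "int (2*n-1) = 2 * int n - 1"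
        "int (2*n-j) = 2 * int n - int j" "int (nat ((int j - int n) ^ 2)) = (int j - int n) ^ 2"
        using assms j by simp_all
      show ?thesis
        unfolding of_nat_add two e_def unfolding of_nat_mult eqs
        by (simp add: algebra_simps power2_eq_square)
    qed
    hence "2 * (j choose 2) + (2*n-1) * (2*n-j) = e + nat ((int j - int n) ^ 2)"
      by (simp only: of_nat_eq_iff)
    hence powers: "(?X ^ 2) ^ (j choose 2) * (?X ^ (2*n-1)) ^ (2*n - j) = ?X ^ e * ?X ^ nat ((int j - int n) ^ 2)"
      by (simp only: power_mult[symmetric] power_add[symmetric])
    have "(?X ^ 2) ^ (j choose 2) * qbin (?X ^ 2) (2*n) j * (-1) ^ j * (?X ^ (2*n-1)) ^ (2*n - j)
        = ((?X ^ 2) ^ (j choose 2) * (?X ^ (2*n-1)) ^ (2*n - j)) * ((-1) ^ j * qbin (?X ^ 2) (2*n) j)"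
      by (simp only: mult_ac)
    thus "(?X ^ 2) ^ (j choose 2) * qbin (?X ^ 2) (2*n) j * (-1) ^ j * (?X ^ (2*n-1)) ^ (2*n - j)
        = ?X ^ e * ((-1) ^ j * (?X ^ nat ((int j - int n) ^ 2) * qbin (?X ^ 2) (2*n) j))"
      unfolding powers by (simp only: mult_ac)
  qed simp
  also have "\<dots> = ?X ^ e * (\<Sum>j\<le>2*n. (-1) ^ j * (?X ^ nat ((int j - int n) ^ 2) * qbin (?X ^ 2) (2*n) j))"
    by (simp only: sum_distrib_left)
  finally have "(-1) ^ n * ?odd ^ 2
      = (\<Sum>j\<le>2*n. (-1) ^ j * (?X ^ nat ((int j - int n) ^ 2) * qbin (?X ^ 2) (2*n) j))"
    by simp
  hence "(-1) ^ n * ((-1) ^ n * ?odd ^ 2)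
      = (\<Sum>j\<le>2*n. (-1) ^ (n + j) * (?X ^ nat ((int j - int n) ^ 2) * qbin (?X ^ 2) (2*n) j))"
    by (simp only: sum_distrib_left power_add mult.assoc)
  thus ?thesis by (simp flip: mult.assoc power_add)
qed

text \<open>When j and N - j are large, all three products in \<open>qbin_mult_qfact\<close> agree
  with \<open>f 2\<close>; cancelling one of them shows that the Gaussian binomial tends to 1 /
  \<open>f 2\<close>.\<close>

lemma agree_qbin_mult_f:
  assumes "m \<le> j" "m \<le> N - j" "j \<le> N"
  shows "agree m (qbin (fps_X ^ 2) N j * f 2) 1"
proof -
  let ?p = "\<lambda>k. \<Prod>i=1..k. 1 - (fps_X ^ 2) ^ i :: int fps"
  have p: "agree m (?p k) (f 2)" if "m \<le> k" for k
    using agree_prod_one_minus_X_power[of 2 m k] that by (simp add: power_mult)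
  have "agree m (qbin (fps_X ^ 2) N j * f 2 * f 2) (qbin (fps_X ^ 2) N j * ?p j * ?p (N - j))"
    using assms by (intro agree_mult agree_refl agree_sym[OF p])
  also have "\<dots> = ?p N" using assms(3) by (rule qbin_mult_qfact)
  also have "agree m (?p N) (f 2)" using assms by (intro p) simp
  finally have "agree m (qbin (fps_X ^ 2) N j * f 2 * f 2 * fps_inv1 (f 2)) (f 2 * fps_inv1 (f 2))"
    by (intro agree_mult agree_refl)
  moreover have "f 2 * fps_inv1 (f 2) = 1" by (rule fps_inv1_right) simp
  ultimately show ?thesis by (simp add: mult.assoc)
qed

lemma odd_even_prod:
  "(\<Prod>i<n. 1 - fps_X ^ (2 * i + 1)) * (\<Prod>k=1..n. 1 - fps_X ^ (2 * k)) =
     (\<Prod>k=1..2*n. 1 - fps_X ^ k :: 'a::comm_ring_1 fps)"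
proof (induction n)
  case (Suc n)
  have "(\<Prod>k=1..2 * Suc n. 1 - fps_X ^ k :: 'a fps) =
      (\<Prod>k=1..2*n. 1 - fps_X ^ k) * ((1 - fps_X ^ (2 * n + 1)) * (1 - fps_X ^ (2 * Suc n)))"
    by (simp add: mult.assoc)
  thus ?case unfolding Suc.IH[symmetric] by (simp add: mult_ac)
qed simp

text \<open>Put x = j - n. The sign depends only on the parity of x, which is that of the exponent
  x^2, and every root x of k <= m satisfies |x| <= n and so is reached.\<close>

lemma agree_alternating_squares:
  assumes "m \<le> n"
  shows "agree m (\<Sum>j\<le>2*n. (-1) ^ (n + j) * fps_X ^ nat ((int j - int n) ^ 2)) alt_theta"
  unfolding agree_def
proof (intro allI impI)
  fix k assume k: "k \<le> m"
  have nth: "fps_nth ((-1) ^ (n + j) * fps_X ^ nat ((int j - int n) ^ 2) :: int fps) k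
      = (if (int j - int n) ^ 2 = int k then (-1) ^ k else 0)" for j
  proof -
    have "fps_nth ((-1) ^ (n + j) * fps_X ^ nat ((int j - int n) ^ 2) :: int fps) k
        = (-1) ^ (n + j) * (if (int j - int n) ^ 2 = int k then 1 else 0)"
      by (cases "even (n + j)") (auto simp: nat_eq_iff)
    moreover have "even (n + j) \<longleftrightarrow> even k" if "(int j - int n) ^ 2 = int k"
    proof -
      have "even (int k) \<longleftrightarrow> even (int j - int n)" unfolding that[symmetric] by simp
      thus ?thesis by auto
    qed
    ultimately show ?thesis by (auto simp: minus_one_power_iff)
  qed
  have "fps_nth (\<Sum>j\<le>2*n. (-1) ^ (n + j) * fps_X ^ nat ((int j - int n) ^ 2) :: int fps) k
      = (\<Sum>j\<le>2*n. if (int j - int n) ^ 2 = int k then (-1) ^ k else 0)"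
    unfolding fps_sum_nth nth ..
  also have "\<dots> = (\<Sum>j\<in>{j. j \<le> 2*n \<and> (int j - int n) ^ 2 = int k}. (-1) ^ k)"
    by (rule sum.mono_neutral_cong_right) auto
  also have "\<dots> = (-1) ^ k * int (card {j. j \<le> 2*n \<and> (int j - int n) ^ 2 = int k})"
    by simp
  also have "card {j. j \<le> 2*n \<and> (int j - int n) ^ 2 = int k} = card {x :: int. x ^ 2 = int k}"
  proof (rule bij_betw_same_card[of "\<lambda>j. int j - int n"], rule bij_betwI')
    fix x :: int assume "x \<in> {x. x ^ 2 = int k}"
    hence "\<bar>x\<bar> \<le> int n" "x ^ 2 = int k" using abs_le_square_int[of x] k assms by auto
    thus "\<exists>j\<in>{j. j \<le> 2*n \<and> (int j - int n) ^ 2 = int k}. x = int j - int n"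
      by (intro bexI[of _ "nat (x + int n)"]) auto
  qed auto
  finally show "fps_nth (\<Sum>j\<le>2*n. (-1) ^ (n + j) * fps_X ^ nat ((int j - int n) ^ 2)) k
      = fps_nth alt_theta k"
    by (simp add: alt_theta_nth theta_def)
qed

theorem alt_theta_eq: "alt_theta * f 2 = f 1 ^ 2"
proof (rule agree_eqI)
  fix m :: nat
  \<comment> \<open>Terms with (j-n)^2 > m are invisible up to degree m. In the others |j-n| <= m,
    and n = 2m + 1 makes both j and 2n - j at least m, as the limit of \<open>qbin\<close>
    requires.\<close>
  define n :: nat where "n = 2 * m + 1"
  let ?odd = "\<Prod>i<n. 1 - fps_X ^ (2 * i + 1) :: int fps"
  let ?t = "\<lambda>j. fps_X ^ nat ((int j - int n) ^ 2) :: int fps"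
  have n: "0 < n" "m \<le> n" by (simp_all add: n_def)
  have odd: "agree m (?odd * f 2) (f 1)"
  proof -
    have "agree m (?odd * f 2) (?odd * (\<Prod>k=1..n. 1 - fps_X ^ (2 * k)))"
      using n by (intro agree_mult agree_refl agree_sym[OF agree_prod_one_minus_X_power]) auto
    also have "\<dots> = (\<Prod>k=1..2*n. 1 - fps_X ^ k)" by (rule odd_even_prod)
    also have "agree m \<dots> (f 1)" using agree_prod_one_minus_X_power[of 1 m "2 * n"] n by simp
    finally show ?thesis .
  qed
  have "agree m (alt_theta * f 2) ((\<Sum>j\<le>2*n. (-1) ^ (n + j) * ?t j) * f 2)"
    by (intro agree_mult agree_refl agree_sym[OF agree_alternating_squares] n)
  also have "agree m \<dots> ((\<Sum>j\<le>2*n. (-1) ^ (n + j) * (?t j * (qbin (fps_X ^ 2) (2*n) j * f 2))) * f 2)"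
  proof (intro agree_mult agree_sum agree_refl)
    fix j assume j: "j \<in> {..2*n}"
    show "agree m (?t j) (?t j * (qbin (fps_X ^ 2) (2*n) j * f 2))"
    proof (cases "m < nat ((int j - int n) ^ 2)")
      case True
      have "agree m (?t j) 0" using agree_X_power_mult[OF True, of 1] by simp
      thus ?thesis using agree_X_power_mult[OF True] agree_sym agree_trans by blast
    next
      case False
      hence "\<bar>int j - int n\<bar> \<le> int m"
        using abs_le_square_int[of "int j - int n"] by linarith
      hence "m \<le> j" "m \<le> 2*n - j" using j by (auto simp: n_def)
      hence "agree m 1 (qbin (fps_X ^ 2) (2*n) j * f 2)"
        using j by (intro agree_sym[OF agree_qbin_mult_f]) auto
      thus ?thesis using agree_mult[OF agree_refl] by (metis mult.right_neutral)
    qed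
  qed
  \<comment> \<open>This is \<open>finite_gauss\<close> times the square of \<open>f 2\<close>: one
    factor sits in each term, the other outside the sum.\<close>
  also have "(\<Sum>j\<le>2*n. (-1) ^ (n + j) * (?t j * (qbin (fps_X ^ 2) (2*n) j * f 2))) * f 2 = (?odd * f 2) ^ 2"
    unfolding power_mult_distrib finite_gauss[OF n(1)]
    by (simp add: sum_distrib_right power2_eq_square mult.assoc)
  also have "agree m \<dots> (f 1 ^ 2)" by (rule agree_power[OF odd])
  finally show "agree m (alt_theta * f 2) (f 1 ^ 2)" .
qed

lemma pbar_gf_mult_alt_theta: "pbar_gf * alt_theta = 1"
proof -
  have "pbar_gf * alt_theta * f 2 = 1 * f 2"
    by (simp only: mult.assoc alt_theta_eq pbar_gf_eq mult_1_left)
  thus ?thesis by (simp only: mult_right_cancel[OF f_nonzero])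
qed

section \<open>Representations by two squares\<close>

text \<open>The map (u, v) -> (u + v, u - v) doubles the norm; it is invertible because x^2 + y^2
  even forces x and y to have equal parity.\<close>

lemma card_two_square_reps_double: "card (two_square_reps (2 * n)) = card (two_square_reps n)"
proof (rule sym, rule bij_betw_same_card, rule bij_betwI)
  let ?f = "\<lambda>(u, v). (u + v, u - v) :: int \<times> int"
  let ?g = "\<lambda>(x, y). ((x + y) div 2, (x - y) div 2) :: int \<times> int"
  have even: "even (x + y)" "even (x - y)" if "(x, y) \<in> two_square_reps (2 * n)" for x y
  proof -
    have "x ^ 2 + y ^ 2 = 2 * int n" using that by (simp add: two_square_reps_def)
    hence "even (x ^ 2 + y ^ 2)" by simp
    thus "even (x + y)" "even (x - y)" by simp_all
  qed
  show "?f \<in> two_square_reps n \<rightarrow> two_square_reps (2 * n)"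
    by (auto simp: two_square_reps_def power2_eq_square algebra_simps)
  show "?g \<in> two_square_reps (2 * n) \<rightarrow> two_square_reps n"
  proof clarify
    fix x y assume *: "(x, y) \<in> two_square_reps (2 * n)"
    define u v where "u = (x + y) div 2" and "v = (x - y) div 2"
    have "x + y = 2 * u" "x - y = 2 * v" using even[OF *] by (simp_all add: u_def v_def)
    hence xy: "x = u + v" "y = u - v" by simp_all
    have "(u, v) \<in> two_square_reps n"
      using * unfolding xy by (simp add: two_square_reps_def power2_eq_square algebra_simps)
    thus "((x + y) div 2, (x - y) div 2) \<in> two_square_reps n" by (simp add: u_def v_def)
  qed
  show "?g (?f z) = z" for z by (cases z) simp
  show "?f (?g z) = z" if "z \<in> two_square_reps (2 * n)" for z
  proof -
    obtain x y where z: "z = (x, y)" by (cases z)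
    have "x + y = 2 * ((x + y) div 2)" "x - y = 2 * ((x - y) div 2)"
      using even[of x y] that z by simp_all
    thus ?thesis unfolding z by simp
  qed
qed

text \<open>
  Every Gaussian integer of norm \<open>5n\<close> is divisible by \<open>2 + i\<close> or by \<open>2 - i\<close>, and by both exactly if it is
  divisible by 5.
\<close>

lemma card_two_square_reps_mult_5:
  "int (card (two_square_reps (5 * n))) = 2 * int (card (two_square_reps n))
     - (if 5 dvd n then int (card (two_square_reps (n div 5))) else 0)"
proof -
  define R where "R = two_square_reps (5 * n)"
  define P where "P = {(x, y) \<in> R. 5 dvd 2 * x + y}"
  define M where "M = {(x, y) \<in> R. 5 dvd 2 * x - y}"
  have R: "(x, y) \<in> R \<longleftrightarrow> x ^ 2 + y ^ 2 = 5 * int n" for x y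
    by (simp add: R_def two_square_reps_def)
  have "R \<subseteq> P \<union> M"
  proof clarify
    fix x y assume *: "(x, y) \<in> R" "(x, y) \<notin> M"
    \<comment> \<open>4x^2 - y^2 = 5x^2 - (x^2 + y^2).\<close>
    have "(2 * x + y) * (2 * x - y) = 5 * (x ^ 2 - int n)"
      using *(1) by (simp add: R power2_eq_square algebra_simps)
    hence "5 dvd (2 * x + y) * (2 * x - y)" by simp
    moreover have "prime (5 :: int)" by simp
    ultimately show "(x, y) \<in> P" using * by (auto simp: P_def M_def prime_dvd_mult_iff)
  qed
  hence un: "R = P \<union> M" by (auto simp: P_def M_def)
  \<comment> \<open>Multiplication by 2 + i: (u + iv)(2 + i) = (2u - v) + i(u + 2v). Its image is
    cut out by 5 | 2x + y, the real part of (x + iy)(2 - i).\<close>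
  have "card P = card (two_square_reps n)"
  proof (rule sym, rule bij_betw_same_card[of "\<lambda>(u, v). (2 * u - v, u + 2 * v)"], rule bij_betwI')
    show "((\<lambda>(u, v). (2 * u - v, u + 2 * v)) z = (\<lambda>(u, v). (2 * u - v, u + 2 * v)) w) = (z = w)"
      for z w :: "int \<times> int" by (cases z; cases w) auto
    show "(\<lambda>(u, v). (2 * u - v, u + 2 * v)) z \<in> P" if "z \<in> two_square_reps n" for z :: "int \<times> int"
      using that by (cases z) (auto simp: P_def R two_square_reps_def power2_eq_square algebra_simps)
  next
    fix z assume "z \<in> P"
    then obtain x y where z: "z = (x, y)" "(x, y) \<in> R" "5 dvd 2 * x + y" by (auto simp: P_def)
    then obtain u where u: "2 * x + y = 5 * u" by blast
    define v where "v = 2 * u - x"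
    have xy: "x = 2 * u - v" "y = u + 2 * v" using u by (simp_all add: v_def)
    have "(u, v) \<in> two_square_reps n"
      using z(2) unfolding R xy by (simp add: two_square_reps_def power2_eq_square algebra_simps)
    thus "\<exists>w\<in>two_square_reps n. z = (\<lambda>(u, v). (2 * u - v, u + 2 * v)) w"
      unfolding z(1) xy by force
  qed
  \<comment> \<open>Complex conjugation exchanges the two divisibility conditions.\<close>
  moreover have "card M = card P"
  proof (rule bij_betw_same_card[of "\<lambda>(x, y). (x, - y)"], rule bij_betwI')
    fix z assume "z \<in> P"
    thus "\<exists>w\<in>M. z = (\<lambda>(x, y). (x, - y)) w"
      by (intro bexI[of _ "(\<lambda>(x, y). (x, - y)) z"]) (auto simp: P_def M_def R)
  qed (auto simp: P_def M_def R)
  moreover have "card (P \<inter> M) = (if 5 dvd n then card (two_square_reps (n div 5)) else 0)"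
  proof -
    have "P \<inter> M = (\<lambda>(u, v). (5 * u, 5 * v)) ` {(u, v). 5 * (u ^ 2 + v ^ 2) = int n}"
    proof (rule set_eqI, rule iffI)
      fix z assume "z \<in> P \<inter> M"
      then obtain x y where z: "z = (x, y)" "(x, y) \<in> R" "5 dvd 2 * x + y" "5 dvd 2 * x - y"
        by (auto simp: P_def M_def)
      have "5 dvd x" "5 dvd y" using z(3,4) by presburger+
      then obtain u v where uv: "x = 5 * u" "y = 5 * v" by blast
      thus "z \<in> (\<lambda>(u, v). (5 * u, 5 * v)) ` {(u, v). 5 * (u ^ 2 + v ^ 2) = int n}"
        using z(1,2) by (force simp: R power2_eq_square)
    next
      fix z assume "z \<in> (\<lambda>(u, v). (5 * u, 5 * v)) ` {(u, v). 5 * (u ^ 2 + v ^ 2) = int n}"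
      then obtain u v where uv: "z = (5 * u, 5 * v)" "5 * (u ^ 2 + v ^ 2) = int n" by auto
      have "(5 * u) ^ 2 + (5 * v) ^ 2 = 5 * int n"
        unfolding uv(2)[symmetric] by (simp add: power2_eq_square)
      moreover have "5 dvd 2 * (5 * u) + 5 * v" "5 dvd 2 * (5 * u) - 5 * v" by presburger+
      ultimately show "z \<in> P \<inter> M" by (auto simp: P_def M_def R uv(1))
    qed
    moreover have "inj_on (\<lambda>(u, v). (5 * u, 5 * v) :: int \<times> int) A" for A
      by (auto simp: inj_on_def)
    ultimately have "card (P \<inter> M) = card {(u :: int, v :: int). 5 * (u ^ 2 + v ^ 2) = int n}"
      by (simp add: card_image)
    also have "{(u :: int, v :: int). 5 * (u ^ 2 + v ^ 2) = int n}
        = (if 5 dvd n then two_square_reps (n div 5) else {})"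
    proof (cases "5 dvd n")
      case True
      then obtain k where "n = 5 * k" by blast
      thus ?thesis by (simp add: two_square_reps_def del: distrib_left_numeral)
    next
      case False
      have "5 * w \<noteq> int n" for w :: int using False by presburger
      thus ?thesis using False by (simp del: distrib_left_numeral)
    qed
    finally show ?thesis by simp
  qed
  moreover have "finite P" "finite M"
    using finite_two_square_reps[of "5 * n"]
    by (auto simp: P_def M_def R_def elim!: finite_subset[rotated])
  ultimately show ?thesis
    using card_Un_Int[of P M] unfolding R_def[symmetric] un by (cases "5 dvd n") simp_all
qed

lemma theta_square_nth_double: "fps_nth (theta ^ 2) (2 * n) = fps_nth (theta ^ 2) n"
  by (simp add: theta_square_nth card_two_square_reps_double)

lemma theta_square_nth_mult_5:
  "fps_nth (theta ^ 2) (5 * n) =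
     2 * fps_nth (theta ^ 2) n - (if 5 dvd n then fps_nth (theta ^ 2) (n div 5) else 0)"
  using card_two_square_reps_mult_5[of n] by (simp add: theta_square_nth)

section \<open>Power series supported on a residue class\<close>

text \<open>Residues of exponents act as a grading: they add under multiplication, so many
  coefficients of a product vanish at once.\<close>

definition supported :: "nat \<Rightarrow> nat \<Rightarrow> 'a::comm_ring_1 fps \<Rightarrow> bool" where
  "supported d r F \<longleftrightarrow> (\<forall>n. fps_nth F n \<noteq> 0 \<longrightarrow> n mod d = r mod d)"

lemma supported_nth: "supported d r F \<Longrightarrow> n mod d \<noteq> r mod d \<Longrightarrow> fps_nth F n = 0"
  by (auto simp: supported_def)

lemma fps_mult_nth_nonzeroE:
  fixes F G :: "'a::comm_ring_1 fps"
  assumes "fps_nth (F * G) n \<noteq> 0"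
  obtains i j where "n = i + j" "fps_nth F i \<noteq> 0" "fps_nth G j \<noteq> 0"
proof -
  obtain i where "i \<in> {0..n}" "fps_nth F i * fps_nth G (n - i) \<noteq> 0"
    using assms unfolding fps_mult_nth by (meson sum.neutral)
  thus ?thesis using that[of i "n - i"] by fastforce
qed

lemma supported_mult: "supported d r F \<Longrightarrow> supported d s G \<Longrightarrow> supported d (r + s) (F * G)"
  unfolding supported_def by (blast elim: fps_mult_nth_nonzeroE intro: mod_add_cong)

lemma supported_power: "supported d r F \<Longrightarrow> supported d (k * r) (F ^ k)"
proof (induction k)
  case 0
  show ?case by (auto simp: supported_def)
next
  case (Suc k)
  thus ?case using supported_mult[of d r F "k * r" "F ^ k"] by simp
qed

lemma fps_numeral_mult_nth:
  "fps_nth (numeral k * F) n = numeral k * fps_nth (F :: 'a::comm_ring_1 fps) n"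
  by (simp add: numeral_fps_const)

lemma theta_nth_nonzeroE:
  assumes "fps_nth theta n \<noteq> 0"
  obtains x where "n = x ^ 2"
  using assms theta_nth_eq_0[of n] by blast

section \<open>Jacobi's quartic identity\<close>

text \<open>Odd coefficients cancel; even ones double and are rewritten by r_2(2k) = r_2(k).\<close>

lemma theta_add_squares: "theta ^ 2 + alt_theta ^ 2 = 2 * (theta ^ 2 oo fps_X ^ 2)"
proof (rule fps_ext)
  fix n
  show "fps_nth (theta ^ 2 + alt_theta ^ 2) n = fps_nth (2 * (theta ^ 2 oo fps_X ^ 2)) n"
  proof (cases "even n")
    case True
    then obtain k where "n = 2 * k" by blast
    thus ?thesis
      by (simp add: alt_theta_power fps_nth_compose_minus_X fps_nth_compose_X_power
          theta_square_nth_double fps_numeral_mult_nth)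
  next
    case False
    thus ?thesis
      by (simp add: alt_theta_power fps_nth_compose_minus_X fps_nth_compose_X_power
          fps_numeral_mult_nth)
  qed
qed

text \<open>Let A and B be the sum and difference of \<open>theta\<close> and
  \<open>alt_theta\<close>. They live on even and odd squares, so A^2 and B^2 live on exponents 0
  and 2 modulo 4. Hence A^2 - B^2 arises from A^2 + B^2, a known series in q^2, by replacing q^2
  with -q^2.\<close>

lemma theta_mult_alt_theta: "theta * alt_theta = alt_theta ^ 2 oo fps_X ^ 2"
proof -
  let ?A = "theta + alt_theta" and ?B = "theta - alt_theta"
  have A: "supported 4 0 ?A"
    unfolding supported_def
  proof (intro allI impI)
    fix n assume "fps_nth ?A n \<noteq> 0"
    hence n: "fps_nth theta n \<noteq> 0" "even n"
      by (auto simp: alt_theta_nth minus_one_power_iff split: if_splits)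
    then obtain x where "n = x ^ 2" by (auto elim: theta_nth_nonzeroE)
    moreover from this obtain y where "x = 2 * y" using n(2) by (auto elim: evenE)
    ultimately show "n mod 4 = 0 mod 4" by (simp add: power2_eq_square)
  qed
  have B: "supported 4 1 ?B"
    unfolding supported_def
  proof (intro allI impI)
    fix n assume "fps_nth ?B n \<noteq> 0"
    hence n: "fps_nth theta n \<noteq> 0" "odd n"
      by (auto simp: alt_theta_nth minus_one_power_iff split: if_splits)
    then obtain x where "n = x ^ 2" by (auto elim: theta_nth_nonzeroE)
    moreover from this obtain y where "x = 2 * y + 1" using n(2) by (auto elim: oddE)
    ultimately have "n = 1 + 4 * (y * y + y)" by (simp add: power2_eq_square)
    thus "n mod 4 = 1 mod 4" by simp
  qed
  have sum: "?A ^ 2 + ?B ^ 2 = 4 * (theta ^ 2 oo fps_X ^ 2)"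
  proof -
    have "?A ^ 2 + ?B ^ 2 = 2 * (theta ^ 2 + alt_theta ^ 2)"
      by (simp add: power2_eq_square algebra_simps)
    thus ?thesis by (simp add: theta_add_squares)
  qed
  have "4 * (theta * alt_theta) = 4 * (alt_theta ^ 2 oo fps_X ^ 2)"
  proof (rule fps_ext)
    fix n
    have AB: "4 * (theta * alt_theta) = ?A ^ 2 - ?B ^ 2"
      by (simp add: power2_eq_square algebra_simps)
    have A0: "fps_nth (?A ^ 2) n = 0" if "n mod 4 \<noteq> 0"
      using supported_nth[OF supported_power[OF A, of 2]] that by simp
    have B0: "fps_nth (?B ^ 2) n = 0" if "n mod 4 \<noteq> 2"
      using supported_nth[OF supported_power[OF B, of 2]] that by simp
    have sum_n: "fps_nth (?A ^ 2) n + fps_nth (?B ^ 2) n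
        = 4 * (if even n then fps_nth (theta ^ 2) (n div 2) else 0)"
      using arg_cong[OF sum, of "\<lambda>F. fps_nth F n"]
      by (simp add: fps_numeral_mult_nth fps_nth_compose_X_power)
    have "fps_nth (?A ^ 2) n - fps_nth (?B ^ 2) n
        = 4 * (if even n then (-1) ^ (n div 2) * fps_nth (theta ^ 2) (n div 2) else 0)"
    proof (cases "n mod 4 = 0")
      case True
      hence "even n" "even (n div 2)" by presburger+
      thus ?thesis using sum_n B0 True by simp
    next
      case False
      show ?thesis
      proof (cases "n mod 4 = 2")
        case True
        hence "even n" "odd (n div 2)" by presburger+
        thus ?thesis using sum_n A0 True by simp
      next
        case F: False
        hence "odd n" using False by presburger
        thus ?thesis using A0 B0 False F by simp
      qed
    qed
    thus "fps_nth (4 * (theta * alt_theta)) n = fps_nth (4 * (alt_theta ^ 2 oo fps_X ^ 2)) n"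
      unfolding AB
      by (simp add: fps_numeral_mult_nth fps_nth_compose_X_power alt_theta_power
          fps_nth_compose_minus_X)
  qed
  thus ?thesis by simp
qed

text \<open>Eliminating K gives R (D + E) E(q^2) = E^2 R(q^2) for R = D - E. If R has order r, then
  r + 1 + 2 = 2 + 2r, so r = 1, but equal linear coefficients force r >= 2.\<close>

lemma quadratic_functional_equation_unique:
  fixes D E K :: "int fps"
  assumes D: "D ^ 2 = K * (D oo fps_X ^ 2)" and E: "E ^ 2 = K * (E oo fps_X ^ 2)"
    and "fps_nth D 0 = 0" "fps_nth E 0 = 0" "fps_nth D 1 = fps_nth E 1" "fps_nth E 1 \<noteq> 0"
  shows "D = E"
proof (rule ccontr)
  assume "D \<noteq> E"
  define R where "R = D - E"
  have R: "R \<noteq> 0" using \<open>D \<noteq> E\<close> by (simp add: R_def)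
  have E1: "subdegree E = 1" using assms by (intro subdegreeI) auto
  have DE1: "subdegree (D + E) = 1" using assms by (intro subdegreeI) auto
  have nonzero: "E \<noteq> 0" "D + E \<noteq> 0" using E1 DE1 by auto
  have sub_comp: "subdegree (F oo fps_X ^ 2) = 2 * subdegree F" for F :: "int fps"
    by (simp add: fps_X_power_subdegree)
  have comp_nonzero: "F oo fps_X ^ 2 \<noteq> 0" if "F \<noteq> 0" for F :: "int fps"
  proof -
    have "fps_nth (F oo fps_X ^ 2) (2 * subdegree F) \<noteq> 0"
      using that by (simp add: fps_nth_compose_X_power)
    thus ?thesis by auto
  qed
  have "D ^ 2 * (E oo fps_X ^ 2) = E ^ 2 * (D oo fps_X ^ 2)"
    unfolding D E by (simp add: mult_ac)
  moreover have "D oo fps_X ^ 2 = (E oo fps_X ^ 2) + (R oo fps_X ^ 2)"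
    by (simp add: R_def fps_compose_sub_distrib)
  ultimately have "(D ^ 2 - E ^ 2) * (E oo fps_X ^ 2) = E ^ 2 * (R oo fps_X ^ 2)"
    by (simp add: algebra_simps)
  moreover have "D ^ 2 - E ^ 2 = R * (D + E)"
    by (simp add: R_def power2_eq_square algebra_simps)
  ultimately have "subdegree (R * (D + E) * (E oo fps_X ^ 2)) = subdegree (E ^ 2 * (R oo fps_X ^ 2))"
    by simp
  hence "subdegree R + 1 + 2 = 2 + 2 * subdegree R"
    using R nonzero comp_nonzero[OF R] comp_nonzero[OF nonzero(1)]
    by (simp add: sub_comp E1 DE1 del: subdegree_fps_compose)
  moreover have "subdegree R \<ge> 2"
  proof (rule subdegree_geI[OF R])
    fix i :: nat assume "i < 2"
    hence "i = 0 \<or> i = 1" by auto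
    thus "fps_nth R i = 0" using assms by (auto simp: R_def)
  qed
  ultimately show False by simp
qed

section \<open>Product formulas for theta and Jacobi's identity\<close>

lemma f_compose_X_square: "0 < d \<Longrightarrow> f d oo fps_X ^ 2 = f (2 * d)"
  by (simp add: f_compose_X_power mult.commute)

text \<open>Multiplication by \<open>alt_theta\<close> turns \<open>theta\<close> into the square of
  alt_theta(q^2), and Gauss' formula is available for q and for q^2.\<close>

lemma theta_eq: "theta * f 1 ^ 2 * f 4 ^ 2 = f 2 ^ 5"
proof -
  have "(alt_theta * f 2) oo fps_X ^ 2 = (f 1 ^ 2) oo fps_X ^ 2" by (simp only: alt_theta_eq)
  hence K: "(alt_theta oo fps_X ^ 2) * f 4 = f 2 ^ 2"
    by (simp add: fps_compose_mult_distrib f_compose_X_square flip: fps_compose_power)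
  have "theta * f 1 ^ 2 * f 4 ^ 2 = (theta * alt_theta) * f 4 ^ 2 * f 2"
    unfolding alt_theta_eq[symmetric] by (simp only: mult_ac)
  also have "\<dots> = ((alt_theta oo fps_X ^ 2) * f 4) ^ 2 * f 2"
    by (simp add: theta_mult_alt_theta power_mult_distrib flip: fps_compose_power)
  also have "\<dots> = f 2 ^ 5" unfolding K by (simp flip: power_mult power_Suc2)
  finally show ?thesis .
qed

lemma theta_quartic: "(theta ^ 4 - alt_theta ^ 4) * f 2 ^ 4 = 16 * fps_X * f 4 ^ 8"
proof -
  define u where "u = fps_inv1 (f 2)"
  have u: "f 2 * u = 1" unfolding u_def by (rule fps_inv1_right) simp
  define D where "D = theta ^ 4 - alt_theta ^ 4"
  define E where "E = 16 * fps_X * f 4 ^ 8 * u ^ 4"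
  define H where "H = theta oo fps_X ^ 2"
  define K where "K = alt_theta oo fps_X ^ 2"
  have comp: "F ^ k oo fps_X ^ 2 = (F oo fps_X ^ 2) ^ k" for F :: "int fps" and k
    by (simp add: fps_compose_power)
  have E_eq: "E * f 2 ^ 4 = 16 * fps_X * f 4 ^ 8"
  proof -
    have "E * f 2 ^ 4 = 16 * fps_X * f 4 ^ 8 * (f 2 * u) ^ 4"
      by (simp only: E_def power_mult_distrib mult_ac)
    thus ?thesis by (simp add: u)
  qed
  have D_fun: "D ^ 2 = (16 * H ^ 4) * (D oo fps_X ^ 2)"
  proof -
    have 1: "theta ^ 2 + alt_theta ^ 2 = 2 * H ^ 2" by (simp add: theta_add_squares comp H_def)
    have 2: "theta * alt_theta = K ^ 2" by (simp add: theta_mult_alt_theta comp K_def)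
    \<comment> \<open>D factors as a difference of squares, and (s - t)^2 = (s + t)^2 - 4st
      expresses D^2 through the two known combinations.\<close>
    have "D ^ 2 = ((theta ^ 2 + alt_theta ^ 2) ^ 2 - 4 * (theta * alt_theta) ^ 2)
        * (theta ^ 2 + alt_theta ^ 2) ^ 2"
      unfolding D_def by algebra
    also have "\<dots> = (16 * H ^ 4) * (H ^ 4 - K ^ 4)"
      unfolding 1 2 by algebra
    also have "H ^ 4 - K ^ 4 = D oo fps_X ^ 2"
      by (simp add: D_def fps_compose_sub_distrib comp H_def K_def)
    finally show ?thesis .
  qed
  have E_fun: "E ^ 2 = (16 * H ^ 4) * (E oo fps_X ^ 2)"
  proof -
    have "(theta * f 1 ^ 2 * f 4 ^ 2) oo fps_X ^ 2 = (f 2 ^ 5) oo fps_X ^ 2" by (simp only: theta_eq)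
    hence H_eq: "H * f 2 ^ 2 * f 8 ^ 2 = f 4 ^ 5"
      by (simp add: fps_compose_mult_distrib f_compose_X_square comp H_def)
    have "(E * f 2 ^ 4) oo fps_X ^ 2 = (16 * fps_X * f 4 ^ 8) oo fps_X ^ 2" by (simp only: E_eq)
    hence E2_eq: "(E oo fps_X ^ 2) * f 4 ^ 4 = 16 * fps_X ^ 2 * f 8 ^ 8"
      by (simp add: fps_compose_mult_distrib f_compose_X_square comp)
    \<comment> \<open>The product formulas for H and E(q^2) are inserted after multiplication by
      their common denominator.\<close>
    have "E ^ 2 * (f 2 ^ 8 * f 4 ^ 4 * f 8 ^ 8) = (E * f 2 ^ 4) ^ 2 * (f 4 ^ 4 * f 8 ^ 8)"
      by (simp add: power_mult_distrib mult_ac flip: power_mult)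
    also have "\<dots> = 256 * fps_X ^ 2 * f 4 ^ 20 * f 8 ^ 8"
      unfolding E_eq by (simp add: power_mult_distrib mult_ac flip: power_mult power_add)
    also have "\<dots> = 16 * (H * f 2 ^ 2 * f 8 ^ 2) ^ 4 * ((E oo fps_X ^ 2) * f 4 ^ 4)"
      unfolding H_eq E2_eq by (simp add: mult_ac flip: power_mult)
    also have "\<dots> = (16 * H ^ 4) * (E oo fps_X ^ 2) * (f 2 ^ 8 * f 4 ^ 4 * f 8 ^ 8)"
      by (simp add: power_mult_distrib mult_ac flip: power_mult)
    finally show ?thesis by simp
  qed
  \<comment> \<open>The fourth powers begin 1 + 8q and 1 - 8q.\<close>
  have "fps_nth D 0 = 0" "fps_nth D 1 = 16"
    by (simp_all add: D_def power4_eq_xxxx alt_theta_nth)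
  moreover have "fps_nth E 0 = 0" "fps_nth E 1 = 16"
  proof -
    have "fps_nth u 0 = 1" using arg_cong[OF u, of "\<lambda>F. fps_nth F 0"] by simp
    thus "fps_nth E 0 = 0" "fps_nth E 1 = 16"
      by (simp_all add: E_def mult.assoc fps_numeral_mult_nth fps_power_zeroth)
  qed
  ultimately have "D = E"
    by (intro quadratic_functional_equation_unique[OF D_fun E_fun]) simp_all
  thus ?thesis using E_eq by (simp add: D_def)
qed

text \<open>Multiplying \<open>theta_quartic\<close> by \<open>f 1 ^ 8 * f 4 ^ 8\<close> turns every
  theta power into a product of the \<open>f d\<close>.\<close>

theorem f_quartic: "f 2 ^ 24 = f 1 ^ 16 * f 4 ^ 8 + 16 * (fps_X * f 1 ^ 8 * f 4 ^ 16)"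
proof -
  have "(theta * f 1 ^ 2 * f 4 ^ 2) ^ 4 * f 2 ^ 4 - (alt_theta * f 2) ^ 4 * (f 1 ^ 8 * f 4 ^ 8)
      = ((theta ^ 4 - alt_theta ^ 4) * f 2 ^ 4) * (f 1 ^ 8 * f 4 ^ 8)"
    by (simp add: power_mult_distrib algebra_simps flip: power_mult)
  thus ?thesis
    unfolding theta_eq theta_quartic alt_theta_eq
    by (simp add: algebra_simps flip: power_mult power_add)
qed

section \<open>Reduction modulo 5\<close>

text \<open>Coefficientwise congruence becomes divisibility in the ring of power series, where
  invertible factors can be cancelled.\<close>

lemma numeral_dvd_fps_iff:
  "(numeral k :: int fps) dvd F \<longleftrightarrow> (\<forall>n. numeral k dvd fps_nth F n)"
proof
  assume "numeral k dvd F"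
  thus "\<forall>n. numeral k dvd fps_nth F n"
    by (auto simp: fps_numeral_mult_nth)
next
  assume *: "\<forall>n. numeral k dvd fps_nth F n"
  have "F = numeral k * Abs_fps (\<lambda>n. fps_nth F n div numeral k)"
    by (rule fps_ext) (use * in \<open>simp add: fps_numeral_mult_nth\<close>)
  thus "numeral k dvd F" by (rule dvdI)
qed

section \<open>Fermat's congruence and the Frobenius map modulo 5\<close>

lemma five_dvd_power_5_diff: "5 dvd c ^ 5 - (c :: int)"
proof -
  have "(c ^ 5 - c) mod 5 = ((c mod 5) ^ 5 - c mod 5) mod 5"
    by (rule mod_diff_cong) (simp_all add: power_mod)
  moreover have "(r ^ 5 - r) mod 5 = 0" if "r \<in> {0, 1, 2, 3, 4}" for r :: int
    using that by auto
  moreover have "c mod 5 \<in> {0, 1, 2, 3, 4}" by auto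
  ultimately show ?thesis by (simp only: dvd_eq_mod_eq_0)
qed

text \<open>For polynomials, monomials are added one at a time: the mixed terms of (A + M)^5 are
  multiples of 5, and a monomial is covered by Fermat's congruence. The coefficient of q^n only sees
  a truncation.\<close>

lemma fps_frobenius_5: "5 dvd F ^ 5 - (F oo fps_X ^ 5)" for F :: "int fps"
proof -
  have poly: "5 dvd (\<Sum>i<k. fps_const (c i) * fps_X ^ i) ^ 5
      - ((\<Sum>i<k. fps_const (c i) * fps_X ^ i) oo fps_X ^ 5)" for k and c :: "nat \<Rightarrow> int"
  proof (induction k)
    case 0
    show ?case by simp
  next
    case (Suc k)
    define A where "A = (\<Sum>i<k. fps_const (c i) * fps_X ^ i)"
    define M where "M = fps_const (c k) * fps_X ^ k"
    have M: "5 dvd M ^ 5 - (M oo fps_X ^ 5)"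
    proof -
      have "M oo fps_X ^ 5 = fps_const (c k) * fps_X ^ (k * 5)"
        by (simp add: M_def fps_compose_mult_distrib fps_X_power_compose mult.commute flip: power_mult)
      hence "M ^ 5 - (M oo fps_X ^ 5) = fps_const (c k ^ 5 - c k) * fps_X ^ (k * 5)"
        by (simp add: M_def power_mult_distrib left_diff_distrib
            flip: power_mult fps_const_sub)
      moreover obtain d where "c k ^ 5 - c k = 5 * d" using five_dvd_power_5_diff by blast
      ultimately have "M ^ 5 - (M oo fps_X ^ 5) = 5 * (fps_const d * fps_X ^ (k * 5))"
        by (simp add: numeral_fps_const flip: mult.assoc)
      thus ?thesis by (rule dvdI)
    qed
    have "(A + M) ^ 5 - ((A + M) oo fps_X ^ 5) = (A ^ 5 - (A oo fps_X ^ 5)) + (M ^ 5 - (M oo fps_X ^ 5))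
        + 5 * (A ^ 4 * M + 2 * A ^ 3 * M ^ 2 + 2 * A ^ 2 * M ^ 3 + A * M ^ 4)"
      unfolding fps_compose_add_distrib by algebra
    moreover have "5 dvd A ^ 5 - (A oo fps_X ^ 5)" using Suc.IH by (simp add: A_def)
    ultimately have "5 dvd (A + M) ^ 5 - ((A + M) oo fps_X ^ 5)"
      using M by (simp only: dvd_add dvd_triv_left)
    thus ?case by (simp add: A_def M_def)
  qed
  have "5 dvd fps_nth (F ^ 5 - (F oo fps_X ^ 5)) n" for n
  proof -
    define S where "S = (\<Sum>i<Suc n. fps_const (fps_nth F i) * fps_X ^ i)"
    have S: "agree n F S"
      unfolding agree_def S_def by (auto simp: fps_sum_nth if_distrib cong: if_cong)
    have "agree n (F oo fps_X ^ 5) (S oo fps_X ^ 5)"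
      using S by (auto simp: agree_def fps_nth_compose_X_power)
    moreover have "agree n (F ^ 5) (S ^ 5)" by (rule agree_power[OF S])
    ultimately have "fps_nth (F ^ 5 - (F oo fps_X ^ 5)) n = fps_nth (S ^ 5 - (S oo fps_X ^ 5)) n"
      by (simp add: agree_def)
    thus ?thesis using poly[of "fps_nth F" "Suc n"] by (simp add: numeral_dvd_fps_iff S_def)
  qed
  thus ?thesis by (simp add: numeral_dvd_fps_iff)
qed

text \<open>Extraction of the exponents divisible by k is linear over series in q^k.\<close>

lemma fps_mult_compose_X_power_nth:
  fixes F G :: "'a::comm_ring_1 fps"
  assumes "0 < k"
  shows "fps_nth (F * (G oo fps_X ^ k)) (k * n) = fps_nth (Abs_fps (\<lambda>n. fps_nth F (k * n)) * G) n"
proof -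
  have "fps_nth (F * (G oo fps_X ^ k)) (k * n) = fps_nth ((G oo fps_X ^ k) * F) (k * n)"
    by (simp add: mult.commute)
  also have "\<dots> = (\<Sum>i=0..k * n. fps_nth (G oo fps_X ^ k) i * fps_nth F (k * n - i))"
    by (rule fps_mult_nth)
  also have "\<dots> = (\<Sum>i\<in>(\<lambda>j. k * j) ` {0..n}. fps_nth (G oo fps_X ^ k) i * fps_nth F (k * n - i))"
    using assms
    by (intro sum.mono_neutral_right) (auto simp: fps_nth_compose_X_power)
  also have "\<dots> = (\<Sum>j=0..n. fps_nth G j * fps_nth F (k * (n - j)))"
    using assms
    by (subst sum.reindex) (auto simp: inj_on_def fps_nth_compose_X_power diff_mult_distrib2)
  also have "\<dots> = fps_nth (G * Abs_fps (\<lambda>n. fps_nth F (k * n))) n"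
    by (simp add: fps_mult_nth)
  finally show ?thesis by (simp add: mult.commute)
qed

text \<open>
  Split \<open>\<theta> = a + b + c\<close> by exponents modulo 5. Then \<open>\<theta>\<^sup>2\<close> and \<open>\<theta>\<^sup>4\<close> restricted to exponents
  divisible by 5 are \<open>a\<^sup>2 + 2bc\<close> and \<open>a\<^sup>4 + 12a\<^sup>2bc + 6(bc)\<^sup>2\<close>, and the two-square count determines \<open>bc\<close>.
\<close>

lemma theta_power_4_nth_mult_5:
  "fps_nth (theta ^ 4) (5 * n) =
     6 * fps_nth (theta ^ 4) n - 5 * fps_nth (theta ^ 4 oo fps_X ^ 5) n"
proof -
  define sec where "sec r = Abs_fps (\<lambda>n. if n mod 5 = r then fps_nth theta n else 0)" for r
  define a b c where "a = sec 0" and "b = sec 1" and "c = sec 4"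
  have sec: "supported 5 r (sec r)" for r by (auto simp: supported_def sec_def)
  \<comment> \<open>Squares are 0, 1 or 4 modulo 5, so these three sections exhaust
    \<open>theta\<close>.\<close>
  have theta: "theta = a + b + c"
  proof (rule fps_ext)
    fix n
    show "fps_nth theta n = fps_nth (a + b + c) n"
    proof (cases "fps_nth theta n = 0")
      case False
      then obtain x where "n = x ^ 2" by (rule theta_nth_nonzeroE)
      hence "n mod 5 = (x mod 5) ^ 2 mod 5" by (simp add: power_mod)
      moreover have "x mod 5 \<in> {0, 1, 2, 3, 4}" by auto
      ultimately have "n mod 5 \<in> {0, 1, 4}" by auto
      thus ?thesis by (auto simp: a_def b_def c_def sec_def)
    qed (simp add: a_def b_def c_def sec_def)
  qed
  \<comment> \<open>Monomials in a, b, c, with exponents in the class j + 4k modulo 5; those outside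
    class 0 vanish at 5m.\<close>
  define T where "T i j k = a ^ i * b ^ j * c ^ k" for i j k
  have zero: "fps_nth (T i j k) m = 0" if "m mod 5 \<noteq> (j + k * 4) mod 5" for i j k m
  proof (rule supported_nth)
    show "supported 5 (i * 0 + j * 1 + k * 4) (T i j k)"
      unfolding T_def a_def b_def c_def by (intro supported_mult supported_power sec)
    show "m mod 5 \<noteq> (i * 0 + j * 1 + k * 4) mod 5" using that by simp
  qed
  have square_section: "fps_nth (theta ^ 2) (5 * m) = fps_nth (a ^ 2 + 2 * (b * c)) (5 * m)" for m
  proof -
    have "theta ^ 2 = (a ^ 2 + 2 * (b * c)) + (2 * T 1 1 0 + 2 * T 1 0 1
        + T 0 2 0 + T 0 0 2)"
      unfolding theta T_def by (simp add: power2_eq_square algebra_simps)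
    thus ?thesis by (simp add: fps_numeral_mult_nth zero)
  qed
  \<comment> \<open>A square divisible by 5 is 25 times a square.\<close>
  have a: "a = theta oo fps_X ^ 25"
  proof (rule fps_ext)
    fix n
    have "fps_nth theta n = 0" if "5 dvd n" "\<not> 25 dvd n"
    proof (rule theta_nth_eq_0)
      fix x :: nat
      show "x ^ 2 \<noteq> n"
      proof
        assume x: "x ^ 2 = n"
        have "5 dvd x" using that(1) x prime_dvd_power[of 5 x 2] by simp
        then obtain y where "x = 5 * y" by blast
        hence "n = 25 * y ^ 2" using x by (simp add: power_mult_distrib)
        thus False using that(2) by simp
      qed
    qed
    moreover have "fps_nth theta (25 * k) = fps_nth theta k" for k
    proof -
      have "card {x :: int. x ^ 2 = int k} = card {x :: int. x ^ 2 = int (25 * k)}"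
      proof (rule bij_betw_same_card[of "\<lambda>x. 5 * x"], rule bij_betwI')
        fix x :: int assume "x \<in> {x. x ^ 2 = int (25 * k)}"
        hence x: "x ^ 2 = 25 * int k" by simp
        hence "5 dvd x ^ 2" by simp
        hence "5 dvd x" using prime_dvd_power[of 5 x 2] by simp
        then obtain y where "x = 5 * y" by blast
        thus "\<exists>y\<in>{x. x ^ 2 = int k}. x = 5 * y" using x by (simp add: power_mult_distrib)
      qed (simp_all add: power_mult_distrib)
      thus ?thesis by (simp add: theta_def)
    qed
    ultimately show "fps_nth a n = fps_nth (theta oo fps_X ^ 25) n"
    proof (cases "25 dvd n")
      case True
      then obtain k where k: "n = 25 * k" by blast
      have "25 * k mod 5 = 0" by presburger
      thus ?thesis
        using \<open>\<And>k. fps_nth theta (25 * k) = fps_nth theta k\<close>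
        by (simp add: k a_def sec_def fps_nth_compose_X_power)
    next
      case False
      thus ?thesis
        using \<open>5 dvd n \<Longrightarrow> \<not> 25 dvd n \<Longrightarrow> fps_nth theta n = 0\<close>
        by (auto simp: a_def sec_def fps_nth_compose_X_power)
    qed
  qed
  define H where "H = theta oo fps_X ^ 5"
  \<comment> \<open>The two-square count says that the section a^2 + 2bc of \<open>theta ^ 2\<close>
    equals 2 H^2 - a^2.\<close>
  have bc: "b * c = H ^ 2 - a ^ 2"
  proof -
    have "a ^ 2 + 2 * (b * c) = 2 * (theta ^ 2 oo fps_X ^ 5) - (theta ^ 2 oo fps_X ^ 25)"
    proof (rule fps_ext)
      fix m
      show "fps_nth (a ^ 2 + 2 * (b * c)) m
          = fps_nth (2 * (theta ^ 2 oo fps_X ^ 5) - (theta ^ 2 oo fps_X ^ 25)) m"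
      proof (cases "5 dvd m")
        case True
        then obtain k where k: "m = 5 * k" by blast
        have "25 dvd 5 * k \<longleftrightarrow> 5 dvd k" "5 * k div 25 = k div 5" by presburger+
        thus ?thesis
          using square_section[of k] theta_square_nth_mult_5[of k]
          by (cases "5 dvd k") (simp_all add: k fps_numeral_mult_nth fps_nth_compose_X_power)
      next
        case False
        hence "m mod 5 \<noteq> 0" "\<not> 25 dvd m" by (presburger)+
        thus ?thesis
          using False zero[of m 0 0 2] zero[of m 1 1 0]
          by (simp add: T_def fps_numeral_mult_nth fps_nth_compose_X_power)
      qed
    qed
    also have "\<dots> = 2 * H ^ 2 - a ^ 2" by (simp add: H_def a fps_compose_power)
    finally have "2 * (b * c) = 2 * (H ^ 2 - a ^ 2)" by (simp add: algebra_simps)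
    thus ?thesis by (simp only: mult_cancel_left) simp
  qed
  \<comment> \<open>In degree 4, j + 4k is divisible by 5 only for j = k, which singles out the
    first group of terms.\<close>
  have "theta ^ 4 = (a ^ 4 + 12 * a ^ 2 * (b * c) + 6 * (b * c) ^ 2)
      + (4 * T 3 1 0 + 4 * T 3 0 1 + 6 * T 2 2 0
      + 6 * T 2 0 2 + 12 * T 1 2 1 + 12 * T 1 1 2
      + 4 * T 1 3 0 + 4 * T 1 0 3 + T 0 4 0
      + 4 * T 0 3 1 + 4 * T 0 1 3 + T 0 0 4)"
    unfolding theta T_def by algebra
  hence "fps_nth (theta ^ 4) (5 * n)
      = fps_nth (a ^ 4 + 12 * a ^ 2 * (b * c) + 6 * (b * c) ^ 2) (5 * n)"
    by (simp add: fps_numeral_mult_nth zero)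
  also have "a ^ 4 + 12 * a ^ 2 * (b * c) + 6 * (b * c) ^ 2 = 6 * H ^ 4 - 5 * a ^ 4"
    unfolding bc by algebra
  also have "fps_nth \<dots> (5 * n) = 6 * fps_nth (theta ^ 4) n - 5 * fps_nth (theta ^ 4 oo fps_X ^ 5) n"
  proof -
    have "25 dvd 5 * n \<longleftrightarrow> 5 dvd n" "5 * n div 25 = n div 5" by presburger+
    thus ?thesis
      by (simp add: H_def a fps_numeral_mult_nth fps_compose_power fps_nth_compose_X_power)
  qed
  finally show ?thesis .
qed

text \<open>Modulo 5, 1/alt_theta(q) = alt_theta(q)^4 / alt_theta(q^5). Taking exponents divisible
  by 5 gives \<open>U * alt_theta\<close> on one side and, as r_4(5n) = r_4(n) modulo 5,
  \<open>alt_theta ^ 4\<close> on the other.\<close>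

lemma pbar_mult_5: "5 dvd int (pbar (5 * n)) - fps_nth (alt_theta ^ 3) n"
proof -
  define U where "U = Abs_fps (\<lambda>n. fps_nth pbar_gf (5 * n))"
  have "pbar_gf * alt_theta ^ 5 = alt_theta ^ 4 * (pbar_gf * alt_theta)"
    by (simp add: eval_nat_numeral mult_ac)
  hence "alt_theta ^ 4 - pbar_gf * (alt_theta oo fps_X ^ 5)
      = pbar_gf * (alt_theta ^ 5 - (alt_theta oo fps_X ^ 5))"
    by (simp add: pbar_gf_mult_alt_theta right_diff_distrib)
  hence "5 dvd alt_theta ^ 4 - pbar_gf * (alt_theta oo fps_X ^ 5)"
    using fps_frobenius_5[of alt_theta] by simp
  hence 1: "5 dvd fps_nth (alt_theta ^ 4) (5 * n) - fps_nth (U * alt_theta) n" for n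
    unfolding numeral_dvd_fps_iff
    using fps_mult_compose_X_power_nth[of 5 pbar_gf alt_theta n]
    by (metis U_def fps_sub_nth zero_less_numeral)
  have 2: "5 dvd fps_nth (alt_theta ^ 4) (5 * n) - fps_nth (alt_theta ^ 4) n" for n
  proof -
    \<comment> \<open>5n and n have the same parity, so passing from \<open>theta\<close> to
      \<open>alt_theta\<close> introduces equal signs.\<close>
    have sign: "(-1 :: int) ^ (5 * n) = (-1) ^ n" by (simp add: power_mult)
    have "fps_nth (alt_theta ^ 4) (5 * n) - fps_nth (alt_theta ^ 4) n
        = 5 * ((-1) ^ n * (fps_nth (theta ^ 4) n - fps_nth (theta ^ 4 oo fps_X ^ 5) n))"
      unfolding alt_theta_power fps_nth_compose_minus_X theta_power_4_nth_mult_5 sign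
      by (simp add: algebra_simps)
    thus ?thesis by simp
  qed
  have "5 dvd fps_nth (U * alt_theta - alt_theta ^ 4) n" for n
    using dvd_diff[OF 2[of n] 1[of n]] by simp
  hence "5 dvd U * alt_theta - alt_theta ^ 4" unfolding numeral_dvd_fps_iff by blast
  \<comment> \<open>Multiplying by \<open>pbar_gf\<close>, the inverse of \<open>alt_theta\<close>,
    cancels one factor.\<close>
  hence "5 dvd (U * alt_theta - alt_theta ^ 4) * pbar_gf" by simp
  also have "(U * alt_theta - alt_theta ^ 4) * pbar_gf = (U - alt_theta ^ 3) * (pbar_gf * alt_theta)"
    by (simp add: eval_nat_numeral algebra_simps)
  finally have "5 dvd U - alt_theta ^ 3" by (simp add: pbar_gf_mult_alt_theta)
  thus ?thesis by (simp add: numeral_dvd_fps_iff U_def pbar_gf_def)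
qed

text \<open>Squares are 0, 1 or 4 modulo 8, and no three of these residues add up to 7.\<close>

lemma alt_theta_cube_nth_eq_0: "fps_nth (alt_theta ^ 3) (8 * n + 7) = 0"
proof (rule ccontr)
  assume "fps_nth (alt_theta ^ 3) (8 * n + 7) \<noteq> 0"
  hence "fps_nth (alt_theta * (alt_theta * alt_theta)) (8 * n + 7) \<noteq> 0"
    by (simp add: power3_eq_cube mult.assoc)
  then obtain i l where il: "8 * n + 7 = i + l" "fps_nth alt_theta i \<noteq> 0"
    "fps_nth (alt_theta * alt_theta) l \<noteq> 0" by (rule fps_mult_nth_nonzeroE)
  obtain j k where "l = j + k" "fps_nth alt_theta j \<noteq> 0" "fps_nth alt_theta k \<noteq> 0"
    using il(3) by (rule fps_mult_nth_nonzeroE)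
  with il have n: "8 * n + 7 = i + (j + k)"
    and nonzero: "fps_nth alt_theta i \<noteq> 0" "fps_nth alt_theta j \<noteq> 0" "fps_nth alt_theta k \<noteq> 0"
    by simp_all
  have "(i mod 8 + (j mod 8 + k mod 8)) mod 8 = (8 * n + 7) mod 8"
    unfolding n by (intro mod_add_cong mod_mod_trivial)
  also have "\<dots> = 7" by simp
  finally have sum: "(i mod 8 + (j mod 8 + k mod 8)) mod 8 = 7" .
  have "m mod 8 \<in> {0, 1, 4}" if "fps_nth alt_theta m \<noteq> 0" for m
  proof -
    from that have "fps_nth theta m \<noteq> 0" by (simp add: alt_theta_nth)
    then obtain x where "m = x ^ 2" by (rule theta_nth_nonzeroE)
    hence "m mod 8 = (x mod 8) ^ 2 mod 8" by (simp add: power_mod)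
    moreover have "x mod 8 \<in> {0, 1, 2, 3, 4, 5, 6, 7}" by auto
    ultimately show ?thesis by auto
  qed
  from this[OF nonzero(1)] this[OF nonzero(2)] this[OF nonzero(3)] sum show False by auto
qed

lemma five_dvd_pbar: "5 dvd int (pbar (40 * n + 35))"
proof -
  have "5 dvd int (pbar (5 * (8 * n + 7)))"
    using pbar_mult_5[of "8 * n + 7"] by (simp only: alt_theta_cube_nth_eq_0 diff_0_right)
  moreover have "5 * (8 * n + 7) = 40 * n + 35" by simp
  ultimately show ?thesis by (simp only:)
qed

section \<open>The eta quotients\<close>

lemma fps_inv1_mult: "fps_nth F 0 = 1 \<Longrightarrow> fps_nth G 0 = 1 \<Longrightarrow> fps_inv1 (F * G) = fps_inv1 F * fps_inv1 G"
proof -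
  assume *: "fps_nth F 0 = 1" "fps_nth G 0 = 1"
  have "(F * G) * (fps_inv1 F * fps_inv1 G) = (F * fps_inv1 F) * (G * fps_inv1 G)"
    by (simp only: mult_ac)
  also have "\<dots> = (F * G) * fps_inv1 (F * G)" using * by (simp add: fps_inv1_right)
  finally have "(F * G) * (fps_inv1 F * fps_inv1 G) = (F * G) * fps_inv1 (F * G)" .
  moreover have "F * G \<noteq> 0" using * by auto
  ultimately show ?thesis by simp
qed

lemma fps_inv1_power: "fps_nth F 0 = 1 \<Longrightarrow> fps_inv1 (F ^ k) = fps_inv1 F ^ k"
proof (induction k)
  case 0
  show ?case using fps_inv1_right[of 1] by simp
next
  case (Suc k)
  thus ?case by (simp add: fps_inv1_mult fps_power_zeroth)
qed

lemma power_mult_inverse_power: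
  fixes x u :: "'a::comm_ring_1"
  assumes "x * u = 1" "j \<le> k"
  shows "x ^ k * u ^ j = x ^ (k - j)"
proof -
  have "x ^ k * u ^ j = x ^ (k - j) * (x * u) ^ j"
    using assms(2) by (simp add: power_mult_distrib mult.assoc[symmetric] flip: power_add)
  thus ?thesis by (simp add: assms(1))
qed

theorem theorem2p3:
  fixes n :: nat
  defines "q \<equiv> (fps_X :: int fps)"
  shows "[int (pbar (40 * n + 35)) =
     fps_nth (2 * f 2 ^ 122 * fps_inv1 (f 1 ^ 63 * f 4 ^ 40)
      + 3 * f 1 * f 2 ^ 26 * fps_inv1 (f 4 ^ 8)
      + 4 * q * f 2 ^ 98 * fps_inv1 (f 1 ^ 55 * f 4 ^ 24)
      + 3 * q * f 1 ^ 9 * f 2 ^ 2 * f 4 ^ 8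
      + 4 * q ^ 2 * f 2 ^ 74 * fps_inv1 (f 1 ^ 47 * f 4 ^ 8)
      + 4 * q ^ 3 * f 2 ^ 50 * f 4 ^ 8 * fps_inv1 (f 1 ^ 39)
      + 4 * q ^ 4 * f 2 ^ 26 * f 4 ^ 24 * fps_inv1 (f 1 ^ 31)
      + 2 * q ^ 5 * f 2 ^ 2 * f 4 ^ 40 * fps_inv1 (f 1 ^ 23)) n] (mod 5)"
    (is "[_ = fps_nth ?R n] (mod 5)")
proof -
  define x y z where "x = f 1" and "y = f 2" and "z = f 4"
  define u w where "u = fps_inv1 (f 1)" and "w = fps_inv1 (f 4)"
  define A B C where "A = y ^ 24" and "B = q * x ^ 8 * z ^ 16" and "C = x ^ 16 * z ^ 8"
  have xu: "x * u = 1" and zw: "z * w = 1"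
    by (simp_all add: x_def u_def z_def w_def fps_inv1_right)
  have inv: "fps_inv1 (f 1 ^ i * f 4 ^ j) = u ^ i * w ^ j"
    "fps_inv1 (f 1 ^ i) = u ^ i" "fps_inv1 (f 4 ^ j) = w ^ j" for i j
    by (simp_all add: u_def w_def fps_inv1_mult fps_inv1_power fps_power_zeroth)
  \<comment> \<open>Each summand is g / (x^i z^j); 63 and 40 are the largest exponents that occur,
    so x^63 z^40 clears all denominators.\<close>
  define T where "T g i j = g * (u ^ i * w ^ j)" for g i j
  have clear: "x ^ 63 * z ^ 40 * T g i j = g * (x ^ (63 - i) * z ^ (40 - j))"
    if "i \<le> 63" "j \<le> 40" for g i j
  proof -
    have "x ^ 63 * z ^ 40 * T g i j = g * ((x ^ 63 * u ^ i) * (z ^ 40 * w ^ j))"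
      by (simp only: T_def mult_ac)
    thus ?thesis using that by (simp only: power_mult_inverse_power[OF xu] power_mult_inverse_power[OF zw])
  qed
  define R where "R = ?R"
  have R_eq: "R = T (2 * y ^ 122) 63 40 + T (3 * x * y ^ 26) 0 8
      + T (4 * q * y ^ 98) 55 24 + T (3 * q * x ^ 9 * y ^ 2 * z ^ 8) 0 0
      + T (4 * q ^ 2 * y ^ 74) 47 8 + T (4 * q ^ 3 * y ^ 50 * z ^ 8) 39 0
      + T (4 * q ^ 4 * y ^ 26 * z ^ 24) 31 0 + T (2 * q ^ 5 * y ^ 2 * z ^ 40) 23 0"
    unfolding R_def inv T_def by (simp add: x_def y_def z_def)
  have y_powers: "y ^ 122 = y ^ 2 * A ^ 5" "y ^ 98 = y ^ 2 * A ^ 4" "y ^ 74 = y ^ 2 * A ^ 3"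
    "y ^ 50 = y ^ 2 * A ^ 2" "y ^ 26 = y ^ 2 * A"
    by (simp_all add: A_def flip: power_mult power_add)
  have x_powers: "x * x ^ 63 = x ^ 64" "x ^ 72 = x ^ 8 * x ^ 64" and z_powers: "z ^ 48 = z ^ 16 * z ^ 32"
    by (simp_all flip: power_Suc power_add)
  have CB: "x ^ 64 * z ^ 32 = C ^ 4" by (simp add: C_def power_mult_distrib flip: power_mult)
  have B_powers: "q ^ 2 * x ^ 16 * z ^ 32 = B ^ 2" "q ^ 3 * x ^ 24 * z ^ 48 = B ^ 3"
    "q ^ 4 * x ^ 32 * z ^ 64 = B ^ 4" "q ^ 5 * x ^ 40 * z ^ 80 = B ^ 5"
    by (simp_all add: B_def power_mult_distrib flip: power_mult)
  have BC: "q * x ^ 72 * z ^ 48 = B * C ^ 4"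
    unfolding x_powers z_powers CB[symmetric] B_def by (simp only: mult_ac)
  have "x ^ 63 * z ^ 40 * R = 2 * y ^ 122 + 3 * (y ^ 26 * ((x * x ^ 63) * z ^ 32))
      + 4 * (y ^ 98 * (q * x ^ 8 * z ^ 16)) + 3 * (y ^ 2 * (q * x ^ 72 * z ^ 48))
      + 4 * (y ^ 74 * (q ^ 2 * x ^ 16 * z ^ 32)) + 4 * (y ^ 50 * (q ^ 3 * x ^ 24 * z ^ 48))
      + 4 * (y ^ 26 * (q ^ 4 * x ^ 32 * z ^ 64)) + 2 * (y ^ 2 * (q ^ 5 * x ^ 40 * z ^ 80))"
    unfolding R_eq by (simp add: distrib_left clear) (simp add: mult_ac flip: power_add)
  also have "\<dots> = y ^ 2 * (2 * A ^ 5 + 3 * (A * C ^ 4) + 4 * (A ^ 4 * B) + 3 * (B * C ^ 4)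
      + 4 * (A ^ 3 * B ^ 2) + 4 * (A ^ 2 * B ^ 3) + 4 * (A * B ^ 4) + 2 * B ^ 5)"
    unfolding x_powers(1) CB B_powers BC y_powers B_def[symmetric] by (simp only: algebra_simps)
  \<comment> \<open>Jacobi's identity eliminates A. What remains is a polynomial in B and C all of
    whose coefficients are multiples of 5; that of C^4 B, for instance, is 160 + 48 + 4 + 3 =
    215.\<close>
  also have "A = C + 16 * B"
    using f_quartic by (simp add: A_def B_def C_def x_def y_def z_def q_def)
  also have "y ^ 2 * (2 * (C + 16 * B) ^ 5 + 3 * ((C + 16 * B) * C ^ 4) + 4 * ((C + 16 * B) ^ 4 * B)
      + 3 * (B * C ^ 4) + 4 * ((C + 16 * B) ^ 3 * B ^ 2) + 4 * ((C + 16 * B) ^ 2 * B ^ 3)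
      + 4 * ((C + 16 * B) * B ^ 4) + 2 * B ^ 5)
      = 5 * (y ^ 2 * (C ^ 5 + 43 * C ^ 4 * B + 1076 * C ^ 3 * B ^ 2 + 17652 * C ^ 2 * B ^ 3
          + 144820 * C * B ^ 4 + 475354 * B ^ 5))"
    by algebra
  finally have "5 dvd x ^ 63 * z ^ 40 * R" by simp
  \<comment> \<open>The cleared denominator is invertible, so divisibility by 5 passes back to
    R.\<close>
  hence "5 dvd x ^ 63 * z ^ 40 * R * (u ^ 63 * w ^ 40)" by (rule dvd_mult2)
  also have "x ^ 63 * z ^ 40 * R * (u ^ 63 * w ^ 40) = R * ((x * u) ^ 63 * (z * w) ^ 40)"
    by (simp only: power_mult_distrib mult_ac)
  finally have "5 dvd R" by (simp add: xu zw)
  hence "5 dvd fps_nth ?R n" by (simp only: numeral_dvd_fps_iff R_def)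
  thus ?thesis using five_dvd_pbar[of n] by (simp only: cong_def dvd_imp_mod_0)
qed

end
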